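(* Let $\alpha,k,\beta,\varepsilon,L>0$, $c>0$, $T_{\rm m}\in\mathbb{R}$, and let initial data $(T_0,s_0,v_0)$ and a reference trajectory $s_{\rm r}$ satisfy Assumptions (A1)--(A6) listed in the context. Then the closed-loop system consisting of the plant (P), the tracking control $q_{\rm c}(t)=q_{\rm c}^{\rm r}(t)-c\,(E(t)-E_{\rm r}(t))$, and the feedforward control $q_{\rm c}^{\rm r}$ (all defined in the context), satisfies the safety condition $$T(x,t)\ge T_{\rm m}\qquad\text{for all } x\in(0,s(t)),\ t>0,$$ and $$s_0<s(t)\ \text{ for all } t>0,\qquad s(t)\le\bar s_{\rm r}\ \text{ and }\ \dot s(t)\ge0\ \text{ for all } t\ge0 .$$
   Context: Plant (P) (one-phase Stefan problem with second-order moving boundary), unknowns $T(x,t)$ on $0\le x\le s(t)$ and $s(t)$, with input $q_{\rm c}(t)$: $T_t=\alpha T_{xx}$ for $t>0$, $0<x<s(t)$; $-kT_x(0,t)=q_{\rm c}(t)$; $T(s(t),t)=T_{\rm m}$; $\varepsilon\ddot s(t)=-\dot s(t)-\beta T_x(s(t),t)$; with $s(0)=s_0$, $\dot s(0)=v_0$, $T(x,0)=T_0(x)$ for $x\in(0,s_0]$. Here $\alpha,k,\beta,\varepsilon,L>0$ and $T_{\rm m}\in\mathbb{R}$ are constants ($L$ is the length of the material). Reference solution: given a smooth $s_{\rm r}:[0,\infty)\to\mathbb{R}$, define $a_0(t)=0$, $a_1(t)=-\frac1\beta(\varepsilon\ddot s_{\rm r}(t)+\dot s_{\rm r}(t))$,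 $a_n(t)=\frac1\alpha(\dot a_{n-2}(t)-\dot s_{\rm r}(t)a_{n-1}(t))$ for $n\ge2$, and $$T^{\rm r}(x,t)=T_{\rm m}+\sum_{n=0}^\infty\frac{a_n(t)}{n!}(x-s_{\rm r}(t))^n,\qquad q_{\rm c}^{\rm r}(t)=-k\sum_{n=0}^\infty\frac{a_{n+1}(t)}{n!}(-s_{\rm r}(t))^n .$$ $T^{\rm r}$ is the reference temperature, constructed so as to solve $T^{\rm r}_t=\alpha T^{\rm r}_{xx}$ on $0<x<s_{\rm r}(t)$, $-kT^{\rm r}_x(0,t)=q_{\rm c}^{\rm r}(t)$, $T^{\rm r}(s_{\rm r}(t),t)=T_{\rm m}$, $\varepsilon\ddot s_{\rm r}=-\dot s_{\rm r}-\beta T^{\rm r}_x(s_{\rm r}(t),t)$. Energies: $E(t)=\frac{k}{\alpha}\int_0^{s(t)}(T(x,t)-T_{\rm m})dx+\frac k\beta(\varepsilon\dot s(t)+s(t))$, $E_{\rm r}(t)=\frac{k}{\alpha}\int_0^{s_{\rm r}(t)}(T^{\rm r}(x,t)-T_{\rm m})dx+\frac k\beta(\varepsilon\dot s_{\rm r}(t)+s_{\rm r}(t))$. Assumptions: (A1) $0<s_0<L$, $T_0\in C^1([0,s_0];[T_{\rm m},+\infty))$, $T_0(s_0)=T_{\rm m}$. (A2) $v_0\ge0$. (A3) There are $d\in[1,2]$, $M>0$, $R>0$ with $|s_{\rm r}^{(m+1)}(t)|\le M\,(m!)^d/R^m$ for all integers $m\ge0$ and all $t\ge0$ (superscript $(m)$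 denotes the $m$-th time derivative). (A4) $s_{\rm r}(0)>0$, $\dot s_{\rm r}(t)\ge0$ for all $t\ge0$, and $\lim_{t\to\infty}s_{\rm r}(t)=\bar s_{\rm r}<L$. (A5) The series solution satisfies $T^{\rm r}(x,t)\ge T_{\rm m}$ for all $x\in(0,s_{\rm r}(t))$, $t>0$. (A6) For all $t\ge0$: $E(0)\le E_{\rm r}(0)+\frac1c q_{\rm c}^{\rm r}(t)e^{ct}$ and $E_{\rm r}(t)+(E(0)-E_{\rm r}(0))e^{-ct}<\frac k\beta\bar s_{\rm r}$.
   Formalization: The claim s_0<s(t) fails if T_0=T_m, v_0=0 and q_c=0 on (0,t) (reference starting late from rest), so it is stated for t outside that case; for d=2, where the series may diverge, T^r is assumed to converge and to solve the reference problem. *)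

theory Defs
  imports "HOL-Analysis.Analysis"
begin

(* Functions of time live on [0,\<infinity>). The derivative is taken within that interval: it is the
   two-sided derivative for t > 0 and the right derivative at t = 0, and values of f at negative
   times play no role in it. *)
definition time_deriv :: "(real \<Rightarrow> real) \<Rightarrow> real \<Rightarrow> real" where
  "time_deriv f t = vector_derivative f (at t within {0..})"

definition smooth_in_time :: "(real \<Rightarrow> real) \<Rightarrow> bool" where
  "smooth_in_time f \<longleftrightarrow> (\<forall>m. ((time_deriv ^^ m) f) differentiable_on {0..})"

(* Classical solutions on the whole of [0,\<infinity>): T is continuous up to the boundary (including
   t = 0), T_x is continuous up to the lateral boundaries x = 0 and x = s(t) for t > 0 (there it is
   a one-sided derivative), T_xx and T_t are continuous in the open domain. No sign condition on
   s, on its velocity or on T is built in. Arguments are ordered as in T(x,t). *)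
definition stefan_plant ::
  "real \<Rightarrow> real \<Rightarrow> real \<Rightarrow> real \<Rightarrow> real \<Rightarrow> (real \<Rightarrow> real) \<Rightarrow> (real \<Rightarrow> real \<Rightarrow> real) \<Rightarrow> (real \<Rightarrow> real) \<Rightarrow> bool"
where
  "stefan_plant \<alpha> k \<beta> \<epsilon> Tm qc T s \<longleftrightarrow>
     s differentiable_on {0..} \<and>
     continuous_on {0..} (time_deriv s) \<and>
     time_deriv s differentiable_on {0<..} \<and>
     continuous_on {(x, t). 0 \<le> t \<and> 0 \<le> x \<and> x \<le> s t} (\<lambda>(x, t). T x t) \<and>
     (\<exists>Tx Txx Tt.
        (\<forall>t>0. \<forall>x\<in>{0..s t}.
           ((\<lambda>\<xi>. T \<xi> t) has_real_derivative Tx x t) (at x within {0..s t})) \<and>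
        continuous_on {(x, t). 0 < t \<and> 0 \<le> x \<and> x \<le> s t} (\<lambda>(x, t). Tx x t) \<and>
        (\<forall>t>0. \<forall>x\<in>{0<..<s t}.
           ((\<lambda>\<xi>. Tx \<xi> t) has_real_derivative Txx x t) (at x) \<and>
           ((\<lambda>\<tau>. T x \<tau>) has_real_derivative Tt x t) (at t)) \<and>
        continuous_on {(x, t). 0 < t \<and> 0 < x \<and> x < s t} (\<lambda>(x, t). Txx x t) \<and>
        continuous_on {(x, t). 0 < t \<and> 0 < x \<and> x < s t} (\<lambda>(x, t). Tt x t) \<and>
        (\<forall>t>0. \<forall>x\<in>{0<..<s t}. Tt x t = \<alpha> * Txx x t) \<and>
        (\<forall>t>0. - k * Tx 0 t = qc t) \<and>
        (\<forall>t>0. T (s t) t = Tm) \<and>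
        (\<forall>t>0. \<epsilon> * time_deriv (time_deriv s) t = - time_deriv s t - \<beta> * Tx (s t) t))"

definition stefan_initial ::
  "(real \<Rightarrow> real) \<Rightarrow> real \<Rightarrow> real \<Rightarrow> (real \<Rightarrow> real \<Rightarrow> real) \<Rightarrow> (real \<Rightarrow> real) \<Rightarrow> bool"
where
  "stefan_initial T0 s0 v0 T s \<longleftrightarrow>
     s 0 = s0 \<and> time_deriv s 0 = v0 \<and> (\<forall>x\<in>{0<..s0}. T x 0 = T0 x)"

fun ref_coeff :: "real \<Rightarrow> real \<Rightarrow> real \<Rightarrow> (real \<Rightarrow> real) \<Rightarrow> nat \<Rightarrow> real \<Rightarrow> real" where
  "ref_coeff \<alpha> \<beta> \<epsilon> sr 0 = (\<lambda>t. 0)"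
| "ref_coeff \<alpha> \<beta> \<epsilon> sr (Suc 0) =
     (\<lambda>t. - (1 / \<beta>) * (\<epsilon> * time_deriv (time_deriv sr) t + time_deriv sr t))"
| "ref_coeff \<alpha> \<beta> \<epsilon> sr (Suc (Suc n)) =
     (\<lambda>t. (1 / \<alpha>) * (time_deriv (ref_coeff \<alpha> \<beta> \<epsilon> sr n) t
                    - time_deriv sr t * ref_coeff \<alpha> \<beta> \<epsilon> sr (Suc n) t))"

definition ref_temp ::
  "real \<Rightarrow> real \<Rightarrow> real \<Rightarrow> real \<Rightarrow> (real \<Rightarrow> real) \<Rightarrow> real \<Rightarrow> real \<Rightarrow> real"
where
  "ref_temp \<alpha> \<beta> \<epsilon> Tm sr x t =
     Tm + (\<Sum>n. ref_coeff \<alpha> \<beta> \<epsilon> sr n t / fact n * (x - sr t) ^ n)"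

definition ref_flux ::
  "real \<Rightarrow> real \<Rightarrow> real \<Rightarrow> real \<Rightarrow> (real \<Rightarrow> real) \<Rightarrow> real \<Rightarrow> real"
where
  "ref_flux \<alpha> k \<beta> \<epsilon> sr t =
     - k * (\<Sum>n. ref_coeff \<alpha> \<beta> \<epsilon> sr (Suc n) t / fact n * (- sr t) ^ n)"

(* The two reference series converge where they are used, and T^r solves the equations it is
   constructed to solve, driven by its own boundary flux. *)
definition ref_well_posed ::
  "real \<Rightarrow> real \<Rightarrow> real \<Rightarrow> real \<Rightarrow> real \<Rightarrow> (real \<Rightarrow> real) \<Rightarrow> bool"
where
  "ref_well_posed \<alpha> k \<beta> \<epsilon> Tm sr \<longleftrightarrow>
     (\<forall>t\<ge>0. \<forall>x\<in>{0..sr t}. summable (\<lambda>n. ref_coeff \<alpha> \<beta> \<epsilon> sr n t / fact n * (x - sr t) ^ n)) \<and>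
     (\<forall>t\<ge>0. summable (\<lambda>n. ref_coeff \<alpha> \<beta> \<epsilon> sr (Suc n) t / fact n * (- sr t) ^ n)) \<and>
     stefan_plant \<alpha> k \<beta> \<epsilon> Tm (ref_flux \<alpha> k \<beta> \<epsilon> sr) (ref_temp \<alpha> \<beta> \<epsilon> Tm sr) sr"

(* Energy of the state with temperature profile \<theta>, front position \<sigma> and front velocity v. *)
definition energy ::
  "real \<Rightarrow> real \<Rightarrow> real \<Rightarrow> real \<Rightarrow> real \<Rightarrow> (real \<Rightarrow> real) \<Rightarrow> real \<Rightarrow> real \<Rightarrow> real"
where
  "energy \<alpha> k \<beta> \<epsilon> Tm \<theta> \<sigma> v =
     k / \<alpha> * integral {0..\<sigma>} (\<lambda>x. \<theta> x - Tm) + k / \<beta> * (\<epsilon> * v + \<sigma>)"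

definition traj_energy ::
  "real \<Rightarrow> real \<Rightarrow> real \<Rightarrow> real \<Rightarrow> real \<Rightarrow> (real \<Rightarrow> real \<Rightarrow> real) \<Rightarrow> (real \<Rightarrow> real) \<Rightarrow> real \<Rightarrow> real"
where
  "traj_energy \<alpha> k \<beta> \<epsilon> Tm T s t = energy \<alpha> k \<beta> \<epsilon> Tm (\<lambda>x. T x t) (s t) (time_deriv s t)"

definition ref_energy ::
  "real \<Rightarrow> real \<Rightarrow> real \<Rightarrow> real \<Rightarrow> real \<Rightarrow> (real \<Rightarrow> real) \<Rightarrow> real \<Rightarrow> real"
where
  "ref_energy \<alpha> k \<beta> \<epsilon> Tm sr = traj_energy \<alpha> k \<beta> \<epsilon> Tm (ref_temp \<alpha> \<beta> \<epsilon> Tm sr) sr"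

definition tracking_control ::
  "real \<Rightarrow> real \<Rightarrow> real \<Rightarrow> real \<Rightarrow> real \<Rightarrow> real \<Rightarrow> (real \<Rightarrow> real) \<Rightarrow>
   (real \<Rightarrow> real \<Rightarrow> real) \<Rightarrow> (real \<Rightarrow> real) \<Rightarrow> real \<Rightarrow> real"
where
  "tracking_control \<alpha> k \<beta> \<epsilon> Tm c sr T s t =
     ref_flux \<alpha> k \<beta> \<epsilon> sr t
     - c * (traj_energy \<alpha> k \<beta> \<epsilon> Tm T s t - ref_energy \<alpha> k \<beta> \<epsilon> Tm sr t)"

end

theory Submission
  imports Defs
begin

text \<open>
  The total energy \<open>E\<close> of a solution changes only through the heat input: the heat equation and the front
  law give \<open>E' = q\<close> (\<open>stefan_flow.energy_deriv\<close>, a case of \<open>weighted_mass_balance\<close>). The same holds for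
  the reference with its own input \<open>qr\<close>, so the feedback makes the error \<open>E - Er\<close> equal to
  \<open>(E(0) - Er(0)) exp (-ct)\<close>, and the closed-loop input is \<open>qr(t) - c (E(0) - Er(0)) exp (-ct)\<close>. The first
  energy condition is the statement that this is nonnegative.

  Nonnegative heat input keeps \<open>T \<ge> Tm\<close> by a minimum principle (\<open>nonneg_of_inflow\<close>). Since \<open>T = Tm\<close> at
  the front, \<open>T\<^sub>x \<le> 0\<close> there, and the front law makes \<open>exp (t / \<epsilon>) s'(t)\<close> nondecreasing; so \<open>s' \<ge> 0\<close>.
  All this presupposes \<open>s > 0\<close>, which is not part of the notion of solution, but a front that cannot recede while
  it is positive stays positive (\<open>front_monotone\<close>). Now every part of the energy is nonnegative and
  \<open>(k / \<beta>) s \<le> E\<close>, and the second energy condition bounds \<open>E\<close> by \<open>(k / \<beta>) srbar\<close>.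

  For strict growth, a front that is still at \<open>s0\<close> at time \<open>t\<close> has not moved before, so the front law gives
  \<open>T = Tm\<close> and \<open>T\<^sub>x = 0\<close> at the fixed point \<open>s0\<close>. Weighting the mass by \<open>cosh (l x)\<close> with large \<open>l\<close>
  shows that this forces \<open>T = Tm\<close> everywhere and no heat input (\<open>zero_of_zero_front_flux\<close>).

  The energy balance for the reference requires that the formal series be a solution. At Gevrey order \<open>d = 2\<close>
  this is a hypothesis. For \<open>d < 2\<close> the \<open>l\<close>-th derivative of the \<open>n\<close>-th coefficient is bounded by a geometric factor
  times \<open>((n + 2 l)!) powr (d / 2)\<close>, so that after division by \<open>n!\<close> the series and its derivatives converge
  everywhere, and the recursion of the coefficients is the heat equation (\<open>gevrey_reference.well_posed\<close>).
\<close>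

section \<open>Mass balance of a heat flow below a moving front\<close>

lemma continuous_on_compose_pair:
  assumes f: "continuous_on W (\<lambda>(x, t). f x t)"
    and "continuous_on A a" "continuous_on A b" "\<And>p. p \<in> A \<Longrightarrow> (a p, b p) \<in> W"
  shows "continuous_on A (\<lambda>p. f (a p) (b p))"
proof -
  have "continuous_on A (\<lambda>p. (\<lambda>(x, t). f x t) (a p, b p))"
    using assms by (intro continuous_on_compose2[OF f] continuous_on_Pair) auto
  then show ?thesis
    by simp
qed

lemma chain_rule_partials:
  fixes f ft :: "real \<Rightarrow> real \<Rightarrow> real"
  assumes W: "open W" "(g t, t) \<in> W"
    and fx: "((\<lambda>x. f x t) has_real_derivative fx) (at (g t))"
    and ft: "\<And>x \<tau>. (x, \<tau>) \<in> W \<Longrightarrow> ((\<lambda>\<tau>. f x \<tau>) has_real_derivative ft x \<tau>) (at \<tau>)"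
    and cont: "continuous_on W (\<lambda>(x, \<tau>). ft x \<tau>)"
    and g: "(g has_real_derivative g') (at t)"
  shows "((\<lambda>\<tau>. f (g \<tau>) \<tau>) has_real_derivative fx * g' + ft (g t) t) (at t)"
proof -
  obtain X Y where XY: "open X" "open Y" "(g t, t) \<in> X \<times> Y" "X \<times> Y \<subseteq> W"
    by (rule open_prod_elim[OF W])
  obtain e where e: "e > 0" "ball t e \<subseteq> Y"
    using XY(3) openE[OF XY(2), of t] by auto
  have sub: "X \<times> ball t e \<subseteq> W"
    using XY e by blast
  have D: "((\<lambda>(x, \<tau>). f x \<tau>) has_derivative
      (\<lambda>(hx, h\<tau>). fx * hx + blinfun_apply (blinfun_mult_right (ft (g t) t)) h\<tau>))
      (at (g t, t) within X \<times> ball t e)"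
  proof (rule has_derivative_partialsI)
    show "((\<lambda>x. f x t) has_derivative (*) fx) (at (g t) within X)"
      using fx by (simp add: has_field_derivative_def has_derivative_at_withinI)
    show "((\<lambda>\<tau>. f x \<tau>) has_derivative blinfun_apply (blinfun_mult_right (ft x \<tau>)))
        (at \<tau> within ball t e)" if "x \<in> X" "\<tau> \<in> ball t e" for x \<tau>
    proof -
      have "((\<lambda>\<tau>. f x \<tau>) has_real_derivative ft x \<tau>) (at \<tau>)"
        using that sub by (intro ft) blast
      then show ?thesis
        by (simp add: has_field_derivative_def blinfun_mult_right.rep_eq has_derivative_at_withinI)
    qed
    have "continuous_on (X \<times> ball t e) (\<lambda>p. blinfun_mult_right (case p of (x, \<tau>) \<Rightarrow> ft x \<tau>))"
      by (rule bounded_linear.continuous_on[OF bounded_linear_blinfun_mult_right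
            continuous_on_subset[OF cont sub]])
    then have "continuous_on (X \<times> ball t e) (\<lambda>(x, \<tau>). blinfun_mult_right (ft x \<tau>))"
      by (simp add: case_prod_unfold)
    then show "continuous (at (g t, t) within X \<times> ball t e) (\<lambda>(x, \<tau>). blinfun_mult_right (ft x \<tau>))"
      using XY e by (auto simp: continuous_on_eq_continuous_within)
  qed (use e in auto)
  moreover have "at (g t, t) within X \<times> ball t e = at (g t, t)"
    using XY e by (intro at_within_open) (auto intro: open_Times)
  ultimately have D': "((\<lambda>(x, \<tau>). f x \<tau>) has_derivative (\<lambda>(hx, h\<tau>). fx * hx + ft (g t) t * h\<tau>))
      (at (g t, t))"
    by (simp add: blinfun_mult_right.rep_eq)
  have P: "((\<lambda>\<tau>. (g \<tau>, \<tau>)) has_derivative (\<lambda>h. (g' * h, h))) (at t)"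
    using g by (auto intro!: has_derivative_Pair simp: has_field_derivative_def)
  have "((\<lambda>\<tau>. (\<lambda>(x, \<tau>). f x \<tau>) (g \<tau>, \<tau>)) has_derivative
      (\<lambda>h. (\<lambda>(hx, h\<tau>). fx * hx + ft (g t) t * h\<tau>) (g' * h, h))) (at t)"
    using diff_chain_at[OF P D'] by (simp add: o_def)
  moreover have "(\<lambda>h. (\<lambda>(hx, h\<tau>). fx * hx + ft (g t) t * h\<tau>) (g' * h, h)) = (*) (fx * g' + ft (g t) t)"
    by (auto simp: algebra_simps)
  ultimately show ?thesis
    by (simp add: has_field_derivative_def)
qed

lemma integral_rescale_unit:
  fixes g :: "real \<Rightarrow> real"
  assumes "0 < \<sigma>"
  shows "integral {0..\<sigma>} g = \<sigma> * integral {0..1} (\<lambda>y. g (y * \<sigma>))"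
proof -
  have "(\<lambda>x. x / \<sigma>) ` {0..\<sigma>} = {0..1}"
    using assms by (auto simp: image_iff field_simps intro!: bexI[where x = "\<sigma> * _"])
  then show ?thesis
    using integral_stretch_real[of \<sigma> 0 \<sigma> g] assms by (simp add: mult.commute field_simps)
qed

text \<open>On the closed region the derivatives \<open>ut\<close> and \<open>uxx\<close> need not even be bounded, so differentiation
  under the integral is possible only over \<open>[\<delta>, 1 - \<delta>]\<close>. Continuity down to \<open>\<delta> = 0\<close>
  lets the resulting identity pass to the full interval.\<close>
lemma continuous_on_truncated_integral:
  fixes G :: "real \<Rightarrow> real \<Rightarrow> real"
  assumes G: "continuous_on ({0..1} \<times> P) (\<lambda>(y, t). G y t)"
  shows "continuous_on ({0..1/4} \<times> P) (\<lambda>(\<delta>, t). integral {\<delta>..1 - \<delta>} (\<lambda>y. G y t))"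
proof -
  have aff: "integral {\<delta>..1 - \<delta>} (\<lambda>y. G y t)
      = (1 - 2 * \<delta>) * integral {0..1} (\<lambda>z. G (\<delta> + (1 - 2 * \<delta>) * z) t)"
    if "\<delta> \<in> {0..1/4}" "t \<in> P" for \<delta> t
  proof -
    have "continuous_on {\<delta>..1 - \<delta>} (\<lambda>y. G y t)"
      by (rule continuous_on_compose_pair[OF G]) (use that in \<open>auto intro!: continuous_intros\<close>)
    then have "(\<lambda>y. G y t) integrable_on {\<delta>..1 - \<delta>}"
      by (simp add: integrable_continuous_real)
    then have "((\<lambda>y. G y t) has_integral integral {\<delta>..1 - \<delta>} (\<lambda>y. G y t)) (cbox \<delta> (1 - \<delta>))"
      by (simp add: integrable_integral)
    moreover define m where "m = 1 - 2 * \<delta>"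
    moreover have m: "0 < m" "(1 - \<delta> - \<delta>) /\<^sub>R m = 1"
      using that by (auto simp: m_def)
    ultimately have "((\<lambda>z. G (m * z + \<delta>) t) has_integral
        integral {\<delta>..1 - \<delta>} (\<lambda>y. G y t) / m) {0..1}"
      using has_integral_affinity'[of "\<lambda>y. G y t" _ \<delta> "1 - \<delta>" m \<delta>] m
      by (simp add: divide_inverse_commute)
    from integral_unique[OF this] show ?thesis
      using m(1) unfolding m_def[symmetric] by (simp add: add.commute field_simps)
  qed
  have "continuous_on ({0..1/4} \<times> P)
      (\<lambda>p. (1 - 2 * fst p) * integral (cbox 0 1) (\<lambda>z. G (fst p + (1 - 2 * fst p) * z) (snd p)))"
  proof (intro continuous_intros integral_continuous_on_param)
    have "\<delta> + (1 - 2 * \<delta>) * z \<in> {0..1}" if "\<delta> \<in> {0..1/4}" "z \<in> {0..1}" for \<delta> z :: real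
    proof -
      have "0 \<le> \<delta>" "0 \<le> (1 - 2 * \<delta>) * z" "0 \<le> (1 - 2 * \<delta>) * (1 - z)"
        using that by auto
      then show ?thesis
        by (simp add: algebra_simps)
    qed
    then have "continuous_on (({0..1/4} \<times> P) \<times> cbox 0 1)
        (\<lambda>q. G (fst (fst q) + (1 - 2 * fst (fst q)) * snd q) (snd (fst q)))"
      by (intro continuous_on_compose_pair[OF G] continuous_intros)
        (auto simp only: mem_Times_iff fst_conv snd_conv cbox_interval)
    then show "continuous_on (({0..1/4} \<times> P) \<times> cbox 0 1)
        (\<lambda>(p, z). G (fst p + (1 - 2 * fst p) * z) (snd p))"
      by (simp add: case_prod_unfold)
  qed
  moreover have "(1 - 2 * fst p) * integral (cbox 0 1) (\<lambda>z. G (fst p + (1 - 2 * fst p) * z) (snd p))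
      = (case p of (\<delta>, t) \<Rightarrow> integral {\<delta>..1 - \<delta>} (\<lambda>y. G y t))"
    if "p \<in> {0..1/4} \<times> P" for p
    using aff[of "fst p" "snd p"] that by (simp add: case_prod_unfold mem_Times_iff)
  ultimately show ?thesis
    by (rule continuous_on_eq)
qed

text \<open>The function \<open>u\<close> plays the part of \<open>T - Tm\<close>. Only the regularity of a classical solution is
  required, so nothing is known about \<open>ut\<close> and \<open>uxx\<close> near the lateral boundary, nor about \<open>ux\<close> near time
  zero. The front may a priori move in either direction and even reach the fixed end.\<close>
locale heat_below_front =
  fixes \<alpha> :: real and s s' :: "real \<Rightarrow> real" and u ux uxx ut :: "real \<Rightarrow> real \<Rightarrow> real"
  assumes s_cont: "continuous_on {0..} s"
    and s_deriv: "\<And>t. 0 < t \<Longrightarrow> (s has_real_derivative s' t) (at t)"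
    and s'_cont: "continuous_on {0<..} s'"
    and u_cont: "continuous_on {(x, t). 0 \<le> t \<and> 0 \<le> x \<and> x \<le> s t} (\<lambda>(x, t). u x t)"
    and u_deriv_x: "\<And>x t. 0 < t \<Longrightarrow> x \<in> {0..s t} \<Longrightarrow>
      ((\<lambda>\<xi>. u \<xi> t) has_real_derivative ux x t) (at x within {0..s t})"
    and ux_cont: "continuous_on {(x, t). 0 < t \<and> 0 \<le> x \<and> x \<le> s t} (\<lambda>(x, t). ux x t)"
    and ux_deriv_x: "\<And>x t. 0 < t \<Longrightarrow> x \<in> {0<..<s t} \<Longrightarrow>
      ((\<lambda>\<xi>. ux \<xi> t) has_real_derivative uxx x t) (at x)"
    and u_deriv_t: "\<And>x t. 0 < t \<Longrightarrow> x \<in> {0<..<s t} \<Longrightarrow>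
      ((\<lambda>\<tau>. u x \<tau>) has_real_derivative ut x t) (at t)"
    and ut_cont: "continuous_on {(x, t). 0 < t \<and> 0 < x \<and> x < s t} (\<lambda>(x, t). ut x t)"
    and heat: "\<And>x t. 0 < t \<Longrightarrow> x \<in> {0<..<s t} \<Longrightarrow> ut x t = \<alpha> * uxx x t"
    and u_front: "\<And>t. 0 < t \<Longrightarrow> u (s t) t = 0"
begin

lemma open_interior: "open {(x, t). 0 < t \<and> 0 < x \<and> x < s t}"
proof -
  have "continuous_on (UNIV \<times> {0<..}) (\<lambda>p :: real \<times> real. s (snd p) - fst p)"
    by (intro continuous_intros continuous_on_compose2[OF s_cont]) auto
  then have "open ((\<lambda>p :: real \<times> real. s (snd p) - fst p) -` {0<..} \<inter> (UNIV \<times> {0<..}))"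
    by (subst (asm) continuous_on_open_vimage) (auto intro: open_Times)
  moreover have "open ({0<..} \<times> UNIV :: (real \<times> real) set)"
    by (intro open_Times) auto
  ultimately have "open (((\<lambda>p :: real \<times> real. s (snd p) - fst p) -` {0<..} \<inter> (UNIV \<times> {0<..}))
      \<inter> ({0<..} \<times> UNIV))"
    by (rule open_Int)
  then show ?thesis
    by (rule back_subst[where P = "open"]) auto
qed

lemma u_interior_deriv_x:
  assumes "0 < t" "x \<in> {0<..<s t}"
  shows "((\<lambda>\<xi>. u \<xi> t) has_real_derivative ux x t) (at x)"
proof -
  have "at x within {0..s t} = at x"
    using assms by (intro at_within_interior) auto
  then show ?thesis
    using u_deriv_x[of t x] assms by auto
qed

lemma u_scaled_deriv:
  assumes "0 < t" "0 < s t" "0 < y" "y < 1"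
  shows "((\<lambda>\<tau>. u (y * s \<tau>) \<tau>) has_real_derivative
    ux (y * s t) t * (y * s' t) + ut (y * s t) t) (at t)"
proof (rule chain_rule_partials[where g = "\<lambda>\<tau>. y * s \<tau>" and f = u and ft = ut, OF open_interior])
  show "((\<lambda>\<tau>. y * s \<tau>) has_real_derivative y * s' t) (at t)"
    using s_deriv[OF assms(1)] by (auto intro!: derivative_eq_intros)
  show "(y * s t, t) \<in> {(x, t). 0 < t \<and> 0 < x \<and> x < s t}"
    using assms by auto
  show "((\<lambda>x. u x t) has_real_derivative ux (y * s t) t) (at (y * s t))"
    using assms by (intro u_interior_deriv_x) auto
  show "continuous_on {(x, t). 0 < t \<and> 0 < x \<and> x < s t} (\<lambda>(x, t). ut x t)"
    by (fact ut_cont)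
qed (auto intro: u_deriv_t)

lemma continuous_on_scaled:
  assumes f: "continuous_on {(x, t). t \<in> P \<and> 0 \<le> x \<and> x \<le> s t} (\<lambda>(x, t). f x t)"
    and P: "P \<subseteq> {0..}" "\<And>t. t \<in> P \<Longrightarrow> 0 \<le> s t"
  shows "continuous_on ({0..1} \<times> P) (\<lambda>(y, t). f (y * s t) t)"
proof -
  have "continuous_on ({0..1} \<times> P) (\<lambda>p. s (snd p))"
    using P by (intro continuous_on_compose2[OF s_cont] continuous_intros) auto
  then have "continuous_on ({0..1} \<times> P) (\<lambda>p. f (fst p * s (snd p)) (snd p))"
    using P by (intro continuous_on_compose_pair[OF f] continuous_intros)
      (auto intro: mult_left_le_one_le)
  then show ?thesis
    by (simp add: case_prod_unfold)
qed

lemma continuous_on_mass: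
  assumes P: "P \<subseteq> {0..}" "\<And>t. t \<in> P \<Longrightarrow> 0 < s t" and \<phi>: "continuous_on UNIV \<phi>"
  shows "continuous_on P (\<lambda>t. integral {0..s t} (\<lambda>x. u x t * \<phi> x))"
proof -
  have "continuous_on ({0..1} \<times> P) (\<lambda>(y, t). u (y * s t) t)"
    by (rule continuous_on_scaled[OF continuous_on_subset[OF u_cont]])
      (use P in \<open>auto simp: less_imp_le\<close>)
  then have "continuous_on (P \<times> {0..1}) (\<lambda>p. u (snd p * s (fst p)) (fst p))"
    by (rule continuous_on_compose_pair) (auto intro!: continuous_intros)
  moreover have sP: "continuous_on P s"
    using P by (auto intro: continuous_on_subset[OF s_cont])
  then have "continuous_on (P \<times> {0..1}) (\<lambda>p. s (fst p))"
    by (rule continuous_on_compose2) (auto intro!: continuous_intros)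
  then have "continuous_on (P \<times> {0..1}) (\<lambda>p. \<phi> (snd p * s (fst p)))"
    by (intro continuous_on_compose2[OF \<phi>] continuous_on_mult continuous_on_snd
        continuous_on_id subset_UNIV)
  ultimately have "continuous_on (P \<times> cbox 0 1) (\<lambda>(t, y). u (y * s t) t * \<phi> (y * s t))"
    by (simp add: case_prod_unfold continuous_on_mult)
  then have "continuous_on P (\<lambda>t. s t * integral (cbox 0 1) (\<lambda>y. u (y * s t) t * \<phi> (y * s t)))"
    by (rule continuous_on_mult[OF sP integral_continuous_on_param])
  then show ?thesis
    by (rule continuous_on_eq) (simp add: integral_rescale_unit[OF P(2)])
qed


text \<open>Formally this is Leibniz' rule, the heat equation and two integrations by parts, the moving
  endpoint contributing nothing because \<open>u\<close> vanishes there. The substitution \<open>x = y * s t\<close> makes the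
  interval fixed. On \<open>\<delta> \<le> y \<le> 1 - \<delta>\<close> all functions are smooth enough to differentiate under
  the integral, and the outcome \<open>K \<delta> t\<close> contains no \<open>ut\<close> or \<open>uxx\<close> any more, hence is continuous
  down to \<open>\<delta> = 0\<close>. The limit is taken in the time-integrated identity and the fundamental theorem of
  calculus returns the derivative.

  Constant weights give the energy balance, hyperbolic cosines the rigidity of a front at rest.\<close>
theorem weighted_mass_balance:
  assumes t0: "0 < t0" "0 < s t0"
    and \<phi>: "\<And>x. (\<phi> has_real_derivative \<phi>' x) (at x)"
      "\<And>x. (\<phi>' has_real_derivative \<phi>'' x) (at x)" "continuous_on UNIV \<phi>''"
  shows "((\<lambda>t. integral {0..s t} (\<lambda>x. u x t * \<phi> x)) has_real_derivative
    \<alpha> * (ux (s t0) t0 * \<phi> (s t0) - ux 0 t0 * \<phi> 0 + u 0 t0 * \<phi>' 0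
      + integral {0..s t0} (\<lambda>x. u x t0 * \<phi>'' x))) (at t0)"
proof -
  have "isCont s t0"
    using s_deriv[OF t0(1)] by (rule DERIV_isCont)
  then have "eventually (\<lambda>t. 0 < s t) (nhds t0)"
    using t0(2) by (simp add: isCont_def order_tendstoD(1) tendsto_at_iff_tendsto_nhds)
  then obtain e where e: "e > 0" "\<And>t. dist t t0 < e \<Longrightarrow> 0 < s t"
    unfolding eventually_nhds_metric by blast
  define r where "r = min e t0 / 2"
  have r: "0 < r" "r < t0" "r < e"
    using e t0 by (auto simp: r_def)
  define P where "P = {t0 - r..t0 + r}"
  have P: "0 < t" "0 < s t" if "t \<in> P" for t
    using that r by (auto simp: P_def dist_real_def intro!: e(2))
  have P_sub: "P \<subseteq> {0..}" "P \<subseteq> {0<..}"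
    using P by (auto simp: less_imp_le)
  \<comment> \<open>\<open>A\<close> is an antiderivative in \<open>y\<close> of the rescaled integrand's time derivative, up to the
    term \<open>\<alpha> * G\<close> that carries the second derivative of the weight.\<close>
  define A where "A y t = y * s' t * (u (y * s t) t * \<phi> (y * s t))
    + \<alpha> * (ux (y * s t) t * \<phi> (y * s t) - u (y * s t) t * \<phi>' (y * s t))" for y t
  define G where "G y t = s t * (u (y * s t) t * \<phi>'' (y * s t))" for y t
  define F where "F y t = s t * (u (y * s t) t * \<phi> (y * s t))" for y t
  define Ft where "Ft y t = s' t * (u (y * s t) t * \<phi> (y * s t))
    + s t * ((ux (y * s t) t * (y * s' t) + ut (y * s t) t) * \<phi> (y * s t)
        + u (y * s t) t * (\<phi>' (y * s t) * (y * s' t)))" for y t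
  define J where "J \<delta> t = integral {\<delta>..1 - \<delta>} (\<lambda>y. F y t)" for \<delta> t
  define K where "K \<delta> t = A (1 - \<delta>) t - A \<delta> t + \<alpha> * integral {\<delta>..1 - \<delta>} (\<lambda>y. G y t)" for \<delta> t

  have \<phi>_cont: "continuous_on UNIV \<phi>" "continuous_on UNIV \<phi>'"
    using \<phi>(1,2) by (meson DERIV_isCont continuous_at_imp_continuous_on)+
  have s_cont_P: "continuous_on P s" "continuous_on P s'"
    using P_sub by (auto intro: continuous_on_subset[OF s_cont] continuous_on_subset[OF s'_cont])
  have c_s: "continuous_on ({0..1} \<times> P) (\<lambda>p. s (snd p))" "continuous_on ({0..1} \<times> P) (\<lambda>p. s' (snd p))"
    by (rule continuous_on_compose2[OF s_cont_P(1)] continuous_on_compose2[OF s_cont_P(2)];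
        auto intro!: continuous_intros)+
  have c_x: "continuous_on ({0..1} \<times> P) (\<lambda>p. fst p * s (snd p))"
    by (rule continuous_on_mult[OF _ c_s(1)]) (auto intro!: continuous_intros)
  have c_\<phi>: "continuous_on ({0..1} \<times> P) (\<lambda>p. f (fst p * s (snd p)))"
    if "continuous_on UNIV f" for f :: "real \<Rightarrow> real"
    by (rule continuous_on_compose2[OF that c_x]) simp
  have c_u: "continuous_on ({0..1} \<times> P) (\<lambda>p. u (fst p * s (snd p)) (snd p))"
    using continuous_on_scaled[OF continuous_on_subset[OF u_cont], of P] P_sub(1) P(2)
    by (force simp: case_prod_unfold less_imp_le)
  have c_ux: "continuous_on ({0..1} \<times> P) (\<lambda>p. ux (fst p * s (snd p)) (snd p))"
    using continuous_on_scaled[OF continuous_on_subset[OF ux_cont], of P] P_sub P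
    by (force simp: case_prod_unfold less_imp_le)
  have c_y: "continuous_on ({0..1} \<times> P) (\<lambda>p :: real \<times> real. fst p)"
    by (intro continuous_on_fst continuous_on_id)
  note c_all = c_s c_u c_ux c_y c_\<phi>[OF \<phi>_cont(1)] c_\<phi>[OF \<phi>_cont(2)] c_\<phi>[OF \<phi>(3)]
  have cA: "continuous_on ({0..1} \<times> P) (\<lambda>(y, t). A y t)"
    unfolding A_def case_prod_unfold
    by (intro continuous_on_add continuous_on_diff continuous_on_mult continuous_on_const c_all)
  have cG: "continuous_on ({0..1} \<times> P) (\<lambda>(y, t). G y t)"
    unfolding G_def case_prod_unfold by (intro continuous_on_mult c_all)
  have cF: "continuous_on ({0..1} \<times> P) (\<lambda>(y, t). F y t)"
    unfolding F_def case_prod_unfold by (intro continuous_on_mult c_all)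

  have cJ: "continuous_on ({0..1/4} \<times> P) (\<lambda>(\<delta>, t). J \<delta> t)"
    unfolding J_def by (rule continuous_on_truncated_integral[OF cF])
  have cIG: "continuous_on ({0..1/4} \<times> P) (\<lambda>p. integral {fst p..1 - fst p} (\<lambda>y. G y (snd p)))"
    using continuous_on_truncated_integral[OF cG] by (simp add: case_prod_unfold)
  have cA': "continuous_on ({0..1/4} \<times> P) (\<lambda>p. A (fst p) (snd p))"
    "continuous_on ({0..1/4} \<times> P) (\<lambda>p. A (1 - fst p) (snd p))"
    by (rule continuous_on_compose_pair[OF cA]; auto intro!: continuous_intros)+
  have cK: "continuous_on ({0..1/4} \<times> P) (\<lambda>(\<delta>, t). K \<delta> t)"
    unfolding K_def case_prod_unfold
    by (intro continuous_on_add continuous_on_diff continuous_on_mult continuous_on_const cA' cIG)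

  have derivJ: "(J \<delta> has_real_derivative K \<delta> t) (at t within P)"
    if \<delta>: "\<delta> \<in> {0<..1/4}" and t: "t \<in> P" for \<delta> t
  proof -
    have y01: "0 < y" "y < 1" if "y \<in> {\<delta>..1 - \<delta>}" for y
      using that \<delta> by auto
    have "continuous_on (P \<times> cbox \<delta> (1 - \<delta>)) (\<lambda>(t, y). Ft y t)"
    proof -
      define Q where "Q = {\<delta>..1 - \<delta>} \<times> P"
      have sub: "Q \<subseteq> {0..1} \<times> P"
        using \<delta> by (auto simp: Q_def)
      note c_Q = c_all[THEN continuous_on_subset[OF _ sub]]
      have "continuous_on Q (\<lambda>p. ut (fst p * s (snd p)) (snd p))"
      proof (rule continuous_on_compose_pair[OF ut_cont])
        show "continuous_on Q (\<lambda>p. fst p * s (snd p))"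
          by (rule continuous_on_subset[OF c_x sub])
        show "(fst p * s (snd p), snd p) \<in> {(x, t). 0 < t \<and> 0 < x \<and> x < s t}" if "p \<in> Q" for p
          using that P[of "snd p"] y01[of "fst p"] by (auto simp: Q_def)
      qed (intro continuous_on_snd continuous_on_id)
      then have "continuous_on Q (\<lambda>(y, t). Ft y t)"
        unfolding Ft_def case_prod_unfold by (intro continuous_on_add continuous_on_mult c_Q)
      then have "continuous_on (P \<times> cbox \<delta> (1 - \<delta>)) (\<lambda>p. Ft (snd p) (fst p))"
        by (rule continuous_on_compose_pair)
          (auto simp: Q_def intro: continuous_on_fst continuous_on_snd continuous_on_id)
      then show ?thesis
        by (simp add: case_prod_unfold)
    qed
    moreover have "((\<lambda>t. F y t) has_real_derivative Ft y t) (at t within P)"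
      if "t \<in> P" "y \<in> cbox \<delta> (1 - \<delta>)" for t y
    proof -
      have "((\<lambda>t. u (y * s t) t) has_real_derivative
          ux (y * s t) t * (y * s' t) + ut (y * s t) t) (at t)"
        using that P y01 by (intro u_scaled_deriv) auto
      moreover have "(s has_real_derivative s' t) (at t)"
        using that P by (intro s_deriv)
      moreover have "((\<lambda>t. \<phi> (y * s t)) has_real_derivative \<phi>' (y * s t) * (y * s' t)) (at t)"
        by (rule DERIV_chain2[OF \<phi>(1)]) (use calculation in \<open>auto intro!: derivative_eq_intros\<close>)
      ultimately have "((\<lambda>t. F y t) has_real_derivative Ft y t) (at t)"
        unfolding F_def Ft_def
        by (auto intro!: derivative_eq_intros simp: algebra_simps)
      then show ?thesis
        by (rule has_field_derivative_at_within)
    qed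
    moreover have "(\<lambda>y. F y t) integrable_on cbox \<delta> (1 - \<delta>)" if "t \<in> P" for t
      unfolding box_real
      by (rule integrable_continuous_real, rule continuous_on_compose_pair[OF cF])
        (use that \<delta> in \<open>auto intro!: continuous_intros\<close>)
    ultimately have D: "((\<lambda>t. integral (cbox \<delta> (1 - \<delta>)) (\<lambda>y. F y t)) has_real_derivative
        integral (cbox \<delta> (1 - \<delta>)) (\<lambda>y. Ft y t)) (at t within P)"
      using t by (intro leibniz_rule_field_derivative) (auto simp: P_def)
    have "((\<lambda>y. Ft y t - \<alpha> * G y t) has_integral A (1 - \<delta>) t - A \<delta> t) {\<delta>..1 - \<delta>}"
    proof (rule fundamental_theorem_of_calculus)
      fix y assume y: "y \<in> {\<delta>..1 - \<delta>}"
      have int: "y * s t \<in> {0<..<s t}"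
        using y01[OF y] P[OF t] by auto
      have lin: "((\<lambda>y. y * s t) has_real_derivative s t) (at y)"
        by (auto intro!: derivative_eq_intros)
      note chain = DERIV_chain2[OF _ lin]
      have "((\<lambda>y. A y t) has_real_derivative (Ft y t - \<alpha> * G y t)) (at y)"
        unfolding A_def Ft_def G_def
        by (rule derivative_eq_intros chain[OF u_interior_deriv_x[OF P(1)[OF t] int]]
            chain[OF ux_deriv_x[OF P(1)[OF t] int]] chain[OF \<phi>(1)] chain[OF \<phi>(2)] refl)+
          (simp add: heat[OF P(1)[OF t] int] algebra_simps)
      then show "((\<lambda>y. A y t) has_vector_derivative (Ft y t - \<alpha> * G y t))
          (at y within {\<delta>..1 - \<delta>})"
        by (simp add: has_real_derivative_iff_has_vector_derivative
            has_vector_derivative_at_within)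
    qed (use \<delta> in auto)
    moreover have "(\<lambda>y. G y t) integrable_on {\<delta>..1 - \<delta>}"
      by (rule integrable_continuous_real, rule continuous_on_compose_pair[OF cG])
        (use t \<delta> in \<open>auto intro!: continuous_intros\<close>)
    then have "((\<lambda>y. \<alpha> * G y t) has_integral \<alpha> * integral {\<delta>..1 - \<delta>} (\<lambda>y. G y t)) {\<delta>..1 - \<delta>}"
      by (intro has_integral_mult_right integrable_integral)
    ultimately have "((\<lambda>y. (Ft y t - \<alpha> * G y t) + \<alpha> * G y t) has_integral K \<delta> t) {\<delta>..1 - \<delta>}"
      unfolding K_def by (rule has_integral_add)
    then have "integral {\<delta>..1 - \<delta>} (\<lambda>y. Ft y t) = K \<delta> t"
      by (simp add: integral_unique)
    then show ?thesis
      using D by (simp add: J_def[abs_def])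
  qed

  have sub_P: "{t0 - r..t} \<subseteq> P" if "t \<in> P" for t
    using that by (auto simp: P_def)
  have balance: "J \<delta> t - J \<delta> (t0 - r) - integral {t0 - r..t} (K \<delta>) = 0"
    if \<delta>: "\<delta> \<in> {0<..1/4}" and t: "t \<in> P" for \<delta> t
  proof -
    have "(K \<delta> has_integral J \<delta> t - J \<delta> (t0 - r)) {t0 - r..t}"
    proof (rule fundamental_theorem_of_calculus)
      show "(J \<delta> has_vector_derivative K \<delta> \<tau>) (at \<tau> within {t0 - r..t})"
        if "\<tau> \<in> {t0 - r..t}" for \<tau>
        using DERIV_subset[OF derivJ[OF \<delta>] sub_P[OF t]] that sub_P[OF t]
        by (auto simp: has_real_derivative_iff_has_vector_derivative)
    qed (use t in \<open>simp add: P_def\<close>)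
    then show ?thesis
      by (simp add: integral_unique)
  qed
  have balance0: "J 0 t - J 0 (t0 - r) - integral {t0 - r..t} (K 0) = 0" if t: "t \<in> P" for t
  proof (rule continuous_constant_on_closure[where S = "{0<..1/4}"
        and f = "\<lambda>\<delta>. J \<delta> t - J \<delta> (t0 - r) - integral {t0 - r..t} (K \<delta>)"])
    have "t0 - r \<in> P"
      using r by (simp add: P_def)
    then have "continuous_on {0..1/4} (\<lambda>\<delta>. J \<delta> t)" "continuous_on {0..1/4} (\<lambda>\<delta>. J \<delta> (t0 - r))"
      using t by (auto intro!: continuous_on_compose_pair[OF cJ] continuous_intros)
    moreover have "continuous_on {0..1/4} (\<lambda>\<delta>. integral (cbox (t0 - r) t) (K \<delta>))"
      by (rule integral_continuous_on_param, rule continuous_on_subset[OF cK])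
        (use sub_P[OF t] in auto)
    ultimately show "continuous_on (closure {0<..1/4})
        (\<lambda>\<delta>. J \<delta> t - J \<delta> (t0 - r) - integral {t0 - r..t} (K \<delta>))"
      by (simp add: continuous_on_diff)
  qed (use balance[OF _ t] in auto)

  have "continuous_on {t0 - r..t0 + r} (K 0)"
    unfolding P_def[symmetric]
    by (rule continuous_on_compose_pair[OF cK]) (auto intro!: continuous_intros)
  then have "((\<lambda>t. J 0 (t0 - r) + integral {t0 - r..t} (K 0)) has_real_derivative K 0 t0)
      (at t0 within {t0 - r..t0 + r})"
    using integral_has_real_derivative[of "t0 - r" "t0 + r" "K 0" t0] r
    by (auto intro!: derivative_eq_intros)
  moreover have "at t0 within {t0 - r..t0 + r} = at t0"
    using r by (intro at_within_interior) simp
  ultimately have "((\<lambda>t. J 0 (t0 - r) + integral {t0 - r..t} (K 0)) has_real_derivative K 0 t0) (at t0)"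
    by simp
  then have "((\<lambda>t. integral {0..s t} (\<lambda>x. u x t * \<phi> x)) has_real_derivative K 0 t0) (at t0)"
  proof (rule has_field_derivative_transform_within_open[where S = "{t0 - r<..<t0 + r}"])
    fix t assume "t \<in> {t0 - r<..<t0 + r}"
    then have t: "t \<in> P"
      by (simp add: P_def)
    have "J 0 t = integral {0..s t} (\<lambda>x. u x t * \<phi> x)"
      using integral_rescale_unit[OF P(2)[OF t]] by (simp add: J_def F_def)
    then show "J 0 (t0 - r) + integral {t0 - r..t} (K 0) = integral {0..s t} (\<lambda>x. u x t * \<phi> x)"
      using balance0[OF t] by simp
  qed (use r in auto)
  moreover have "integral {0..1} (\<lambda>y. G y t0) = integral {0..s t0} (\<lambda>x. u x t0 * \<phi>'' x)"
    using integral_rescale_unit[OF t0(2)] by (simp add: G_def)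
  then have "K 0 t0 = \<alpha> * (ux (s t0) t0 * \<phi> (s t0) - ux 0 t0 * \<phi> 0 + u 0 t0 * \<phi>' 0
      + integral {0..s t0} (\<lambda>x. u x t0 * \<phi>'' x))"
    by (simp add: K_def A_def u_front[OF t0(1)] algebra_simps)
  ultimately show ?thesis
    by simp
qed

end

section \<open>Minimum principle and rigidity\<close>

context heat_below_front
begin

text \<open>The minimum principle for inflow at the fixed end. A negative value of \<open>u\<close> would survive in
  \<open>w = u + \<delta> * (C + t - x)\<close> for a small positive \<open>\<delta>\<close>. The three parts of the correction make
  every comparison strict: \<open>C\<close> keeps \<open>w\<close> positive at the front and nonnegative initially, the slope in
  \<open>x\<close> excludes a minimum at the fixed end without Hopf's lemma, and the slope in \<open>t\<close> turns \<open>w\<close> into a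
  strict supersolution, which excludes an interior minimum.\<close>
theorem nonneg_of_inflow:
  assumes \<alpha>: "0 < \<alpha>"
    and s_pos: "\<And>t. t \<in> {0..b} \<Longrightarrow> 0 < s t"
    and init: "\<And>x. x \<in> {0..s 0} \<Longrightarrow> 0 \<le> u x 0"
    and inflow: "\<And>t. t \<in> {0<..b} \<Longrightarrow> ux 0 t \<le> 0"
    and xt: "t \<in> {0..b}" "x \<in> {0..s t}"
  shows "0 \<le> u x t"
proof (rule ccontr)
  assume "\<not> 0 \<le> u x t"
  then have neg: "u x t < 0"
    by simp
  define D where "D = {(x, t). t \<in> {0..b} \<and> x \<in> {0..s t}}"
  have s_cont_b: "continuous_on {0..b} s"
    by (rule continuous_on_subset[OF s_cont]) auto
  have D_image: "D = (\<lambda>p. (fst p * s (snd p), snd p)) ` ({0..1} \<times> {0..b})"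
  proof
    show "D \<subseteq> (\<lambda>p. (fst p * s (snd p), snd p)) ` ({0..1} \<times> {0..b})"
    proof
      fix p assume "p \<in> D"
      then obtain x t where p: "p = (x, t)" "t \<in> {0..b}" "x \<in> {0..s t}"
        by (auto simp: D_def)
      then show "p \<in> (\<lambda>p. (fst p * s (snd p), snd p)) ` ({0..1} \<times> {0..b})"
        using s_pos[OF p(2)] by (intro image_eqI[where x = "(x / s t, t)"]) auto
    qed
  qed (use s_pos in \<open>auto simp: D_def less_imp_le mult_left_le_one_le\<close>)
  have "compact D"
    unfolding D_image
    by (intro compact_continuous_image compact_Times compact_Icc continuous_on_Pair
        continuous_on_mult continuous_on_fst continuous_on_snd continuous_on_id
        continuous_on_compose2[OF s_cont_b]) auto
  have "bounded (s ` {0..b})"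
    by (intro compact_imp_bounded compact_continuous_image s_cont_b compact_Icc)
  then obtain C0 where "\<forall>z \<in> s ` {0..b}. norm z \<le> C0"
    unfolding bounded_iff by blast
  then have C0: "\<bar>s t\<bar> \<le> C0" if "t \<in> {0..b}" for t
    using that by auto
  define C where "C = C0 + 1"
  have C: "s t < C" if "t \<in> {0..b}" for t
    using C0[OF that] by (simp add: C_def)
  have C_pos: "0 < C" "0 \<le> b"
    using C[OF xt(1)] s_pos[OF xt(1)] xt(1) by auto
  define \<delta> where "\<delta> = - u x t / (2 * (C + b))"
  have \<delta>: "0 < \<delta>"
    using neg C_pos by (simp add: \<delta>_def divide_neg_pos)
  define w where "w x t = u x t + \<delta> * (C + t - x)" for x t
  have "w x t < 0"
  proof -
    have "\<delta> * (C + t - x) \<le> \<delta> * (C + b)"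
      using xt \<delta> by (intro mult_left_mono) auto
    also have "\<dots> = - u x t / 2"
      using C_pos by (simp add: \<delta>_def field_simps)
    finally show ?thesis
      using neg by (simp add: w_def)
  qed
  have "continuous_on D (\<lambda>p. u (fst p) (snd p))"
    by (rule continuous_on_compose_pair[OF u_cont])
      (auto simp: D_def intro: continuous_on_fst continuous_on_snd continuous_on_id)
  then have "continuous_on D (\<lambda>p. w (fst p) (snd p))"
    unfolding w_def by (intro continuous_intros)
  moreover have "(x, t) \<in> D"
    using xt by (simp add: D_def)
  ultimately obtain p where p: "p \<in> D" "\<And>q. q \<in> D \<Longrightarrow> w (fst p) (snd p) \<le> w (fst q) (snd q)"
    using continuous_attains_inf[OF \<open>compact D\<close>, of "\<lambda>p. w (fst p) (snd p)"] by blast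
  obtain x1 t1 where p_eq: "p = (x1, t1)"
    by (cases p)
  have t1: "t1 \<in> {0..b}" and x1: "x1 \<in> {0..s t1}"
    using p(1) by (auto simp: p_eq D_def)
  have min: "w x1 t1 \<le> w x t" if "t \<in> {0..b}" "x \<in> {0..s t}" for x t
    using p(2)[of "(x, t)"] that by (auto simp: p_eq D_def)
  have neg1: "w x1 t1 < 0"
    using min[OF xt] \<open>w x t < 0\<close> by simp
  have "t1 \<noteq> 0"
  proof
    assume "t1 = 0"
    then have "0 \<le> u x1 t1" "0 \<le> \<delta> * (C + t1 - x1)"
      using init[of x1] x1 C[OF t1] \<delta> by auto
    then show False
      using neg1 by (simp add: w_def)
  qed
  then have t1_pos: "0 < t1"
    using t1 by auto
  have s1: "0 < s t1"
    using s_pos t1 by blast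
  have wx: "((\<lambda>x. w x t1) has_real_derivative ux x t1 - \<delta>) (at x within {0..s t1})"
    if "x \<in> {0..s t1}" for x
    unfolding w_def using u_deriv_x[OF t1_pos that]
    by (auto intro!: derivative_eq_intros)
  have "x1 \<noteq> s t1"
  proof
    assume "x1 = s t1"
    then have "w x1 t1 = \<delta> * (C + t1 - s t1)"
      using u_front[OF t1_pos] by (simp add: w_def)
    moreover have "0 < \<delta> * (C + t1 - s t1)"
      using \<delta> C[OF t1] t1_pos by (intro mult_pos_pos) auto
    ultimately show False
      using neg1 by simp
  qed
  \<comment> \<open>The slope of \<open>w\<close> at the fixed end is at most \<open>- \<delta>\<close>, so the minimum is not there either.\<close>
  have "x1 \<noteq> 0"
  proof
    assume "x1 = 0"
    have "ux 0 t1 - \<delta> < 0"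
      using inflow[of t1] t1 t1_pos \<delta> by auto
    then obtain d where d: "d > 0" "\<And>h. 0 < h \<Longrightarrow> 0 + h \<in> {0..s t1} \<Longrightarrow> h < d \<Longrightarrow> w (0 + h) t1 < w 0 t1"
      using has_real_derivative_neg_dec_right[OF wx[of 0]] s1 by auto
    define h where "h = min d (s t1) / 2"
    have "0 < h" "h < d" "h \<le> s t1"
      using d(1) s1 by (auto simp: h_def)
    then show False
      using d(2)[of h] min[OF t1, of h] \<open>x1 = 0\<close> by auto
  qed
  then have x1_int: "x1 \<in> {0<..<s t1}"
    using x1 \<open>x1 \<noteq> s t1\<close> by auto
  have wx_int: "((\<lambda>x. w x t1) has_real_derivative ux x t1 - \<delta>) (at x)" if "x \<in> {0<..<s t1}" for x
    unfolding w_def using u_interior_deriv_x[OF t1_pos that]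
    by (auto intro!: derivative_eq_intros)
  define r where "r = min x1 (s t1 - x1)"
  have r: "0 < r" "x \<in> {0<..<s t1}" if "\<bar>x1 - x\<bar> < r" for x
    using x1_int that by (auto simp: r_def abs_less_iff)
  \<comment> \<open>At the remaining, interior minimum: \<open>w\<close> is critical and convex in \<open>x\<close>, so the heat equation
    makes it strictly increase in time, and it was smaller a moment before.\<close>
  have "ux x1 t1 - \<delta> = 0"
  proof (rule DERIV_local_min[OF wx_int[OF x1_int]])
    show "0 < r"
      using x1_int by (simp add: r_def)
    show "\<forall>y. \<bar>x1 - y\<bar> < r \<longrightarrow> w x1 t1 \<le> w y t1"
      using r(2) min[OF t1] by fastforce
  qed
  have "0 \<le> uxx x1 t1"
  proof (rule ccontr)
    assume "\<not> 0 \<le> uxx x1 t1"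
    then obtain d where d: "d > 0" "\<And>h. 0 < h \<Longrightarrow> h < d \<Longrightarrow> ux (x1 + h) t1 < ux x1 t1"
      using DERIV_neg_dec_right[OF ux_deriv_x[OF t1_pos x1_int]] by auto
    define h where "h = min d (s t1 - x1) / 2"
    have h: "0 < h" "h < d" "x1 + h < s t1"
      using d(1) x1_int by (auto simp: h_def min_def field_simps)
    obtain z where z: "x1 < z" "z < x1 + h" "w (x1 + h) t1 - w x1 t1 = (x1 + h - x1) * (ux z t1 - \<delta>)"
    proof -
      have "\<exists>z>x1. z < x1 + h \<and> w (x1 + h) t1 - w x1 t1 = (x1 + h - x1) * (ux z t1 - \<delta>)"
        using h x1_int by (intro MVT2 wx_int) auto
      then show ?thesis
        using that by blast
    qed
    have "ux z t1 - \<delta> < 0"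
      using d(2)[of "z - x1"] z(1,2) h(2) \<open>ux x1 t1 - \<delta> = 0\<close> by simp
    then have "w (x1 + h) t1 < w x1 t1"
      using z(3) h(1) mult_pos_neg[of h "ux z t1 - \<delta>"] by simp
    then show False
      using min[OF t1, of "x1 + h"] h x1_int by auto
  qed
  have "((\<lambda>t. w x1 t) has_real_derivative ut x1 t1 + \<delta>) (at t1)"
    unfolding w_def using u_deriv_t[OF t1_pos x1_int] by (auto intro!: derivative_eq_intros)
  moreover have "0 < ut x1 t1 + \<delta>"
    using heat[OF t1_pos x1_int] \<open>0 \<le> uxx x1 t1\<close> \<alpha> \<delta> by (simp add: add_nonneg_pos)
  ultimately obtain d where d: "d > 0" "\<And>h. 0 < h \<Longrightarrow> h < d \<Longrightarrow> w x1 (t1 - h) < w x1 t1"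
    using DERIV_pos_inc_left by blast
  have "isCont s t1"
    using s_deriv[OF t1_pos] by (rule DERIV_isCont)
  then have "eventually (\<lambda>t. x1 < s t) (nhds t1)"
    using x1_int by (simp add: isCont_def order_tendstoD(1) tendsto_at_iff_tendsto_nhds)
  then obtain e where e: "e > 0" "\<And>t. dist t t1 < e \<Longrightarrow> x1 < s t"
    unfolding eventually_nhds_metric by blast
  define h where "h = min d (min e t1) / 2"
  have h: "0 < h" "h < d" "h < e" "h < t1"
    using d(1) e(1) t1_pos by (auto simp: h_def)
  have "w x1 (t1 - h) < w x1 t1"
    using d(2) h by blast
  moreover have "x1 < s (t1 - h)"
    using h by (intro e(2)) (simp add: dist_real_def)
  ultimately show False
    using min[of "t1 - h" x1] h t1 x1_int by auto
qed

text \<open>With a resting front and both \<open>u\<close> and \<open>ux\<close> zero there, the mass \<open>I l t\<close> weighted by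
  \<open>cosh (l * x)\<close> satisfies \<open>I' \<ge> \<alpha> * l^2 * I\<close>: the weight is an eigenfunction of the second derivative,
  it is flat at the fixed end, and the inflow only adds. So \<open>I\<close> grows from time \<open>a\<close> to \<open>b\<close> at least by
  \<open>exp (\<alpha> * l^2 * (b - a))\<close>, whereas the weight itself is at most \<open>exp (l * \<sigma>)\<close>. A quadratic exponent
  beats a linear one as \<open>l\<close> grows, so there was no mass at time \<open>a\<close>. This takes the place of a boundary
  point lemma or of unique continuation.\<close>
theorem zero_of_zero_front_flux:
  assumes \<alpha>: "0 < \<alpha>" and ab: "0 < a" "a < b" and \<sigma>: "0 < \<sigma>"
    and s_const: "\<And>t. t \<in> {a..b} \<Longrightarrow> s t = \<sigma>"
    and nonneg: "\<And>x t. t \<in> {a..b} \<Longrightarrow> x \<in> {0..\<sigma>} \<Longrightarrow> 0 \<le> u x t"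
    and inflow: "\<And>t. t \<in> {a..b} \<Longrightarrow> ux 0 t \<le> 0"
    and front: "\<And>t. t \<in> {a..b} \<Longrightarrow> ux \<sigma> t = 0"
    and x: "x \<in> {0..\<sigma>}"
  shows "u x a = 0"
proof -
  have u_cont_x: "continuous_on {0..\<sigma>} (\<lambda>x. u x t)" if "t \<in> {a..b}" for t
    by (rule continuous_on_compose_pair[OF u_cont])
      (use that ab s_const[OF that] in \<open>auto intro: continuous_on_id continuous_on_const\<close>)
  define I where "I l t = integral {0..\<sigma>} (\<lambda>x. u x t * cosh (l * x))" for l t
  have int: "(\<lambda>x. u x t * cosh (l * x)) integrable_on {0..\<sigma>}" if "t \<in> {a..b}" for l t
    by (intro integrable_continuous_real continuous_on_mult u_cont_x that)
      (auto intro!: continuous_intros)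
  define m where "m = integral {0..\<sigma>} (\<lambda>x. u x a)"
  define U where "U = integral {0..\<sigma>} (\<lambda>x. u x b)"
  have int1: "(\<lambda>x. u x t) integrable_on {0..\<sigma>}" if "t \<in> {a..b}" for t
    by (intro integrable_continuous_real u_cont_x that)
  have a_in: "a \<in> {a..b}" and b_in: "b \<in> {a..b}"
    using ab by auto
  have growth: "exp (\<alpha> * l^2 * (b - a)) * I l a \<le> I l b" for l
  proof -
    define J where "J t = integral {0..s t} (\<lambda>x. u x t * cosh (l * x))" for t
    have J: "J t = I l t" if "t \<in> {a..b}" for t
      using s_const[OF that] by (simp add: J_def I_def)
    have "((\<lambda>t. exp (- (\<alpha> * l^2 * t)) * J t) has_real_derivative
        exp (- (\<alpha> * l^2 * t)) * (\<alpha> * (- ux 0 t))) (at t)" if t: "t \<in> {a..b}" for t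
    proof -
      have "(J has_real_derivative \<alpha> * (ux (s t) t * cosh (l * s t) - ux 0 t * cosh (l * 0)
          + u 0 t * (l * sinh (l * 0)) + integral {0..s t} (\<lambda>x. u x t * (l^2 * cosh (l * x))))) (at t)"
        unfolding J_def
      proof (rule weighted_mass_balance)
        show "((\<lambda>x. cosh (l * x)) has_real_derivative l * sinh (l * x)) (at x)" for x
          by (auto intro!: derivative_eq_intros)
        show "((\<lambda>x. l * sinh (l * x)) has_real_derivative l^2 * cosh (l * x)) (at x)" for x
          by (auto intro!: derivative_eq_intros simp: power2_eq_square)
        show "continuous_on UNIV (\<lambda>x. l^2 * cosh (l * x))"
          by (auto intro!: continuous_intros)
      qed (use t ab \<sigma> s_const[OF t] in auto)
      moreover have "(\<lambda>x. u x t * (l^2 * cosh (l * x))) = (\<lambda>x. l^2 * (u x t * cosh (l * x)))"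
        by (auto simp: algebra_simps)
      ultimately have "(J has_real_derivative \<alpha> * (- ux 0 t + l^2 * J t)) (at t)"
        using s_const[OF t] front[OF t] by (simp add: J_def)
      then show ?thesis
        by (auto intro!: derivative_eq_intros simp: algebra_simps)
    qed
    note deriv = this
    have "exp (- (\<alpha> * l^2 * a)) * J a \<le> exp (- (\<alpha> * l^2 * b)) * J b"
    proof (rule DERIV_nonneg_imp_nondecreasing[where f = "\<lambda>t. exp (- (\<alpha> * l^2 * t)) * J t"])
      fix t assume "a \<le> t" "t \<le> b"
      then have t: "t \<in> {a..b}"
        by simp
      have "0 \<le> exp (- (\<alpha> * l^2 * t)) * (\<alpha> * (- ux 0 t))"
        using \<alpha> inflow[OF t] by (intro mult_nonneg_nonneg) auto
      then show "\<exists>y. ((\<lambda>t. exp (- (\<alpha> * l^2 * t)) * J t) has_real_derivative y) (at t) \<and> 0 \<le> y"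
        using deriv[OF t] by blast
    qed (use ab in simp)
    then have "exp (\<alpha> * l^2 * b) * (exp (- (\<alpha> * l^2 * a)) * J a)
        \<le> exp (\<alpha> * l^2 * b) * (exp (- (\<alpha> * l^2 * b)) * J b)"
      by (intro mult_left_mono) auto
    then show ?thesis
      using J[OF a_in] J[OF b_in]
      by (simp add: mult.assoc[symmetric] exp_add[symmetric] right_diff_distrib)
  qed
  have lower: "m \<le> I l a" for l
    unfolding m_def I_def
  proof (rule integral_le[OF int1[OF a_in] int[OF a_in]])
    show "u x a \<le> u x a * cosh (l * x)" if "x \<in> {0..\<sigma>}" for x
      using mult_left_mono[OF cosh_real_ge_1 nonneg[OF a_in that], of "l * x"] by simp
  qed
  have upper: "I l b \<le> U * exp (l * \<sigma>)" if "0 \<le> l" for l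
  proof -
    have "I l b \<le> integral {0..\<sigma>} (\<lambda>x. u x b * exp (l * \<sigma>))"
      unfolding I_def
    proof (rule integral_le[OF int[OF b_in]])
      show "(\<lambda>x. u x b * exp (l * \<sigma>)) integrable_on {0..\<sigma>}"
        by (intro integrable_on_mult_left int1[OF b_in])
      fix x assume x: "x \<in> {0..\<sigma>}"
      have "cosh (l * x) \<le> exp (l * x)"
        using x that by (simp add: cosh_def exp_le_cancel_iff)
      also have "\<dots> \<le> exp (l * \<sigma>)"
        using x that by (simp add: mult_left_mono)
      finally show "u x b * cosh (l * x) \<le> u x b * exp (l * \<sigma>)"
        using nonneg[OF b_in x] by (rule mult_left_mono)
    qed
    then show ?thesis
      by (simp add: U_def)
  qed
  have "m \<le> 0"
  proof (rule ccontr)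
    assume "\<not> m \<le> 0"
    define c where "c = \<alpha> * (b - a)"
    have c: "0 < c"
      using \<alpha> ab by (simp add: c_def)
    \<comment> \<open>The first bound gives \<open>l + l * \<sigma> \<le> \<alpha> * l^2 * (b - a)\<close>; the second makes
      \<open>exp l * m\<close> exceed \<open>U\<close>.\<close>
    define l where "l = max ((\<sigma> + 1) / c) (U / m)"
    have l: "(\<sigma> + 1) / c \<le> l" "U / m \<le> l"
      by (auto simp: l_def)
    have "0 < l"
      using l(1) \<sigma> c by (smt (verit) divide_pos_pos)
    have "\<sigma> + 1 \<le> l * c"
      using l(1) c by (simp add: field_simps)
    then have "l * (\<sigma> + 1) \<le> l * (l * c)"
      using \<open>0 < l\<close> by simp
    then have "l + l * \<sigma> \<le> \<alpha> * l^2 * (b - a)"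
      by (simp add: c_def power2_eq_square algebra_simps)
    then have "exp l * exp (l * \<sigma>) \<le> exp (\<alpha> * l^2 * (b - a))"
      by (simp flip: exp_add)
    then have "(exp l * exp (l * \<sigma>)) * m \<le> exp (\<alpha> * l^2 * (b - a)) * I l a"
      using lower[of l] \<open>\<not> m \<le> 0\<close> by (intro mult_mono) auto
    also have "\<dots> \<le> U * exp (l * \<sigma>)"
      using growth[of l] upper[of l] \<open>0 < l\<close> by simp
    finally have "(exp l * m) * exp (l * \<sigma>) \<le> U * exp (l * \<sigma>)"
      by (simp add: algebra_simps)
    then have "exp l * m \<le> U"
      by simp
    moreover have "U \<le> l * m"
      using l(2) \<open>\<not> m \<le> 0\<close> by (simp add: field_simps)
    moreover have "l * m < exp l * m"
    proof (rule mult_strict_right_mono)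
      show "l < exp l"
        using exp_ge_add_one_self[of l] by linarith
    qed (use \<open>\<not> m \<le> 0\<close> in simp)
    ultimately show False
      by simp
  qed
  moreover have "0 \<le> m"
    unfolding m_def using nonneg[OF a_in] by (intro integral_nonneg int1[OF a_in]) auto
  ultimately have "integral {0..\<sigma>} (\<lambda>x. u x a) = 0"
    by (simp add: m_def)
  then show ?thesis
    using integral_eq_0_iff[OF u_cont_x[OF a_in] \<sigma>] nonneg[OF a_in] x by auto
qed

end

section \<open>Monotonicity of the front\<close>

lemma at_within_nonneg_eq_at: "0 < t \<Longrightarrow> at t within {0..} = at t" for t :: real
  by (rule at_within_open_subset[where S = "{0<..}"]) auto

lemma has_time_deriv:
  assumes "f differentiable_on {0..}" "0 \<le> t"
  shows "(f has_real_derivative time_deriv f t) (at t within {0..})"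
proof -
  have "f differentiable (at t within {0..})"
    using assms by (simp add: differentiable_on_def)
  then show ?thesis
    by (simp add: time_deriv_def has_real_derivative_iff_has_vector_derivative
        vector_derivative_works[symmetric])
qed

lemma has_time_deriv_at:
  assumes "f differentiable_on {0<..}" "0 < t"
  shows "(f has_real_derivative time_deriv f t) (at t)"
proof -
  have "f differentiable (at t within {0<..})"
    using assms by (simp add: differentiable_on_def)
  moreover have "at t within {0<..} = at t"
    using assms(2) by (intro at_within_open) auto
  ultimately show ?thesis
    using assms(2)
    by (simp add: time_deriv_def at_within_nonneg_eq_at has_real_derivative_iff_has_vector_derivative
        vector_derivative_works[symmetric])
qed

locale stefan_flow = heat_below_front \<alpha> s s' u ux uxx ut
  for \<alpha> :: real and s s' :: "real \<Rightarrow> real" and u ux uxx ut :: "real \<Rightarrow> real \<Rightarrow> real" +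
  fixes \<beta> \<epsilon> :: real
  assumes pos: "0 < \<alpha>" "0 < \<beta>" "0 < \<epsilon>"
    and s'_cont0: "continuous_on {0..} s'"
    and s'_deriv: "\<And>t. 0 < t \<Longrightarrow>
      (s' has_real_derivative (- s' t - \<beta> * ux (s t) t) / \<epsilon>) (at t)"
begin

lemma energy_continuous:
  assumes "P \<subseteq> {0..}" "\<And>t. t \<in> P \<Longrightarrow> 0 < s t"
  shows "continuous_on P (\<lambda>t. k / \<alpha> * integral {0..s t} (\<lambda>x. u x t) + k / \<beta> * (\<epsilon> * s' t + s t))"
  using continuous_on_mass[OF assms, of "\<lambda>_. 1"] assms(1) pos
  by (auto intro!: continuous_intros continuous_on_subset[OF s_cont] continuous_on_subset[OF s'_cont0])

text \<open>Heat that leaves through the front is stored in \<open>\<epsilon> * s' + s\<close> at the rate the front law dictates, so the total energy changes only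
  by the flux at the fixed end.\<close>
lemma energy_deriv:
  assumes t: "0 < t" "0 < s t"
  shows "((\<lambda>t. k / \<alpha> * integral {0..s t} (\<lambda>x. u x t) + k / \<beta> * (\<epsilon> * s' t + s t))
    has_real_derivative - k * ux 0 t) (at t)"
proof -
  have "((\<lambda>t. integral {0..s t} (\<lambda>x. u x t * 1)) has_real_derivative
      \<alpha> * (ux (s t) t * 1 - ux 0 t * 1 + u 0 t * 0 + integral {0..s t} (\<lambda>x. u x t * 0))) (at t)"
    by (rule weighted_mass_balance[OF t]) auto
  then have "((\<lambda>t. integral {0..s t} (\<lambda>x. u x t)) has_real_derivative
      \<alpha> * (ux (s t) t - ux 0 t)) (at t)"
    by simp
  then have "((\<lambda>t. k / \<alpha> * integral {0..s t} (\<lambda>x. u x t) + k / \<beta> * (\<epsilon> * s' t + s t))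
      has_real_derivative k / \<alpha> * (\<alpha> * (ux (s t) t - ux 0 t))
        + k / \<beta> * (\<epsilon> * ((- s' t - \<beta> * ux (s t) t) / \<epsilon>) + s' t)) (at t)"
    by (intro DERIV_add DERIV_cmult s'_deriv s_deriv t)
  then show ?thesis
    using pos by (simp add: field_simps)
qed

lemma front_flux_nonpos:
  assumes t: "0 < t" "0 < s t" and nonneg: "\<And>x. x \<in> {0..s t} \<Longrightarrow> 0 \<le> u x t"
  shows "ux (s t) t \<le> 0"
proof (rule ccontr)
  assume "\<not> ux (s t) t \<le> 0"
  then obtain d where d: "d > 0" "\<And>h. 0 < h \<Longrightarrow> s t - h \<in> {0..s t} \<Longrightarrow> h < d \<Longrightarrow> u (s t - h) t < u (s t) t"
    using has_real_derivative_pos_inc_left[OF u_deriv_x[OF t(1), of "s t"]] t by auto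
  define h where "h = min d (s t) / 2"
  have "0 < h" "h < d" "h \<le> s t"
    using d(1) t by (auto simp: h_def)
  then show False
    using d(2)[of h] nonneg[of "s t - h"] u_front[OF t(1)] by auto
qed

text \<open>The velocity equation reads \<open>(exp (t / \<epsilon>) * s')' = - \<beta> / \<epsilon> * exp (t / \<epsilon>) * ux (s t) t\<close>, whose
  right-hand side is nonnegative while the front flux is nonpositive.\<close>
lemma velocity_lower_bound:
  assumes b: "0 \<le> b" and flux: "\<And>t. t \<in> {0<..<b} \<Longrightarrow> ux (s t) t \<le> 0"
  shows "exp (- b / \<epsilon>) * s' 0 \<le> s' b"
proof -
  have "exp (0 / \<epsilon>) * s' 0 \<le> exp (b / \<epsilon>) * s' b"
  proof (rule DERIV_nonneg_imp_increasing_open[where f = "\<lambda>t. exp (t / \<epsilon>) * s' t"])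
    show "continuous_on {0..b} (\<lambda>t. exp (t / \<epsilon>) * s' t)"
      using pos by (auto intro!: continuous_intros continuous_on_subset[OF s'_cont0])
    fix t assume t: "0 < t" "t < b"
    have "((\<lambda>t. exp (t / \<epsilon>) * s' t) has_real_derivative
        exp (t / \<epsilon>) * (- \<beta> / \<epsilon> * ux (s t) t)) (at t)"
      using pos by (auto intro!: derivative_eq_intros s'_deriv[OF t(1)] simp: field_simps)
    moreover have "0 \<le> exp (t / \<epsilon>) * (- \<beta> / \<epsilon> * ux (s t) t)"
      using flux[of t] t pos by (intro mult_nonneg_nonneg mult_nonpos_nonpos) auto
    ultimately show "\<exists>y. ((\<lambda>t. exp (t / \<epsilon>) * s' t) has_real_derivative y) (at t) \<and> 0 \<le> y"
      by blast
  qed fact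
  then have "exp (- b / \<epsilon>) * s' 0 \<le> exp (- b / \<epsilon>) * (exp (b / \<epsilon>) * s' b)"
    by (intro mult_left_mono) auto
  then show ?thesis
    by (simp add: mult.assoc[symmetric] exp_add[symmetric])
qed

text \<open>The minimum principle needs a region of positive width, so this first version takes it as a
  hypothesis up to time \<open>b\<close>; its last conclusion then rules out that the width is ever lost.\<close>
lemma front_monotone_while_positive:
  assumes v0: "0 \<le> s' 0"
    and init: "\<And>x. x \<in> {0<..s 0} \<Longrightarrow> 0 \<le> u x 0"
    and b: "0 \<le> b" and s_pos: "\<And>t. t \<in> {0..b} \<Longrightarrow> 0 < s t"
    and inflow: "\<And>t. t \<in> {0<..b} \<Longrightarrow> ux 0 t \<le> 0"
  shows "\<forall>x\<in>{0..s b}. 0 \<le> u x b" "exp (- b / \<epsilon>) * s' 0 \<le> s' b" "s 0 \<le> s b"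
proof -
  have s0: "0 < s 0"
    using s_pos[of 0] b by simp
  have init0: "0 \<le> u x 0" if "x \<in> {0..s 0}" for x
  proof (rule continuous_ge_on_closure[where S = "{0<..s 0}" and f = "\<lambda>x. u x 0"])
    have "continuous_on {0..s 0} (\<lambda>x. u x 0)"
      by (rule continuous_on_compose_pair[OF u_cont])
        (auto intro: continuous_on_id continuous_on_const)
    then show "continuous_on (closure {0<..s 0}) (\<lambda>x. u x 0)"
      using s0 by simp
  qed (use that s0 init in auto)
  have nonneg: "0 \<le> u x t" if "t \<in> {0..b}" "x \<in> {0..s t}" for x t
    by (rule nonneg_of_inflow[where b = b and t = t]) (use pos(1) s_pos init0 inflow that in auto)
  then show "\<forall>x\<in>{0..s b}. 0 \<le> u x b"
    using b by auto
  have velocity: "exp (- t / \<epsilon>) * s' 0 \<le> s' t" if "t \<in> {0..b}" for t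
    using that by (intro velocity_lower_bound front_flux_nonpos s_pos nonneg) auto
  then show "exp (- b / \<epsilon>) * s' 0 \<le> s' b"
    using b by auto
  show "s 0 \<le> s b"
  proof (rule DERIV_nonneg_imp_increasing_open[OF b])
    show "continuous_on {0..b} s"
      by (rule continuous_on_subset[OF s_cont]) auto
    fix t assume t: "0 < t" "t < b"
    then have "0 \<le> s' t"
      using velocity[of t] v0 by (smt (verit) atLeastAtMost_iff exp_ge_zero mult_nonneg_nonneg)
    then show "\<exists>y. (s has_real_derivative y) (at t) \<and> 0 \<le> y"
      using s_deriv[OF t(1)] by blast
  qed
qed

text \<open>If the front ever came down to half its initial height, consider the first such time \<open>b\<close>. Up to
  \<open>b\<close> the front is positive, hence by \<open>front_monotone_while_positive\<close> it is still at least at its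
  initial height at \<open>b\<close>. Stopping at one half instead of zero keeps the width positive at \<open>b\<close> itself.
  The inflow is only assumed as long as the front has been positive, because for the closed loop
  the sign of the input is obtained from the energy balance, which has the same restriction.\<close>
theorem front_monotone:
  assumes s0: "0 < s 0" and v0: "0 \<le> s' 0"
    and init: "\<And>x. x \<in> {0<..s 0} \<Longrightarrow> 0 \<le> u x 0"
    and inflow: "\<And>t. 0 < t \<Longrightarrow> (\<And>\<tau>. \<tau> \<in> {0..t} \<Longrightarrow> 0 < s \<tau>) \<Longrightarrow> ux 0 t \<le> 0"
    and t: "0 \<le> t"
  shows "s 0 \<le> s t" "exp (- t / \<epsilon>) * s' 0 \<le> s' t" "\<forall>x\<in>{0..s t}. 0 \<le> u x t"
proof -
  have step: "\<forall>x\<in>{0..s b}. 0 \<le> u x b" "exp (- b / \<epsilon>) * s' 0 \<le> s' b" "s 0 \<le> s b"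
    if "0 \<le> b" "\<And>t. t \<in> {0..b} \<Longrightarrow> 0 < s t" for b
    using front_monotone_while_positive[OF v0 init that] inflow that(2) by auto
  have s_pos: "0 < s t" if t: "0 \<le> t" for t
  proof (rule ccontr)
    assume "\<not> 0 < s t"
    have s_cont_Icc: "continuous_on {0..\<tau>} s" for \<tau>
      by (rule continuous_on_subset[OF s_cont]) auto
    have half: "\<exists>x\<in>{0..\<tau>}. s x = s 0 / 2" if "0 \<le> \<tau>" "s \<tau> \<le> 0" for \<tau>
      using IVT2'[of s \<tau> "s 0 / 2" 0] that s0 s_cont_Icc[of \<tau>] by auto
    define Z where "Z = {0..t} \<inter> s -` {s 0 / 2}"
    have "closed Z"
      unfolding Z_def by (rule continuous_closed_preimage[OF s_cont_Icc]) auto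
    moreover have "bounded Z"
      unfolding Z_def by (rule bounded_subset[OF bounded_closed_interval[of 0 t]]) auto
    ultimately have "compact Z"
      by (simp add: compact_eq_bounded_closed)
    moreover have "Z \<noteq> {}"
      using half[of t] t \<open>\<not> 0 < s t\<close> by (auto simp: Z_def)
    ultimately obtain b where b: "b \<in> Z" "\<And>t. t \<in> Z \<Longrightarrow> b \<le> t"
      using compact_attains_inf[of Z] by blast
    have "0 < s \<tau>" if \<tau>: "\<tau> \<in> {0..b}" for \<tau>
    proof (rule ccontr)
      assume neg: "\<not> 0 < s \<tau>"
      then obtain x where x: "x \<in> {0..\<tau>}" "s x = s 0 / 2"
        using half[of \<tau>] \<tau> by auto
      then have "x \<in> Z"
        using \<tau> b(1) by (auto simp: Z_def)
      then have "\<tau> = b"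
        using b(2)[of x] x \<tau> by auto
      then show False
        using b(1) s0 neg by (simp add: Z_def)
    qed
    then have "s 0 \<le> s b"
      using b(1) by (intro step(3)) (auto simp: Z_def)
    then show False
      using b(1) s0 by (simp add: Z_def)
  qed
  show "s 0 \<le> s t" "exp (- t / \<epsilon>) * s' 0 \<le> s' t" "\<forall>x\<in>{0..s t}. 0 \<le> u x t"
    using step[OF t] s_pos by auto
qed

text \<open>A front at rest has no velocity and no acceleration, so the front law makes the heat flux vanish
  there as well, and \<open>zero_of_zero_front_flux\<close> applies.\<close>
theorem stationary_front_imp_equilibrium:
  assumes b: "0 < b" and s0: "0 < s 0"
    and stationary: "\<And>t. t \<in> {0..b} \<Longrightarrow> s t = s 0"
    and nonneg: "\<And>x t. t \<in> {0..b} \<Longrightarrow> x \<in> {0..s 0} \<Longrightarrow> 0 \<le> u x t"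
    and inflow: "\<And>t. t \<in> {0<..b} \<Longrightarrow> ux 0 t \<le> 0"
  shows "\<And>t. t \<in> {0<..<b} \<Longrightarrow> ux 0 t = 0" "\<And>x. x \<in> {0..s 0} \<Longrightarrow> u x 0 = 0"
proof -
  have locally_const: "l = 0" if t: "t \<in> {0<..<b}" and f: "\<And>t. t \<in> {0<..<b} \<Longrightarrow> f t = c"
      and l: "(f has_real_derivative l) (at t)" for f :: "real \<Rightarrow> real" and l t c
  proof (rule DERIV_local_const[OF l])
    show "0 < min t (b - t)"
      using t by auto
    show "\<forall>\<tau>. \<bar>t - \<tau>\<bar> < min t (b - t) \<longrightarrow> f t = f \<tau>"
      using f t by (auto simp: abs_less_iff)
  qed
  have v: "s' t = 0" if "t \<in> {0<..<b}" for t
  proof (rule locally_const[OF that, where f = s and c = "s 0"])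
    show "(s has_real_derivative s' t) (at t)"
      using that by (intro s_deriv) simp
  qed (auto intro!: stationary)
  have front: "ux (s 0) t = 0" if t: "t \<in> {0<..<b}" for t
  proof -
    have "(- s' t - \<beta> * ux (s t) t) / \<epsilon> = 0"
    proof (rule locally_const[OF t, where f = s' and c = 0])
      show "(s' has_real_derivative (- s' t - \<beta> * ux (s t) t) / \<epsilon>) (at t)"
        using t by (intro s'_deriv) simp
    qed (simp add: v)
    then show ?thesis
      using v[OF t] pos stationary[of t] t by auto
  qed
  have zero: "u x t = 0" if t: "t \<in> {0<..<b}" and x: "x \<in> {0..s 0}" for x t
  proof (rule zero_of_zero_front_flux[OF pos(1), of t "(t + b) / 2" "s 0"])
    show "s \<tau> = s 0" if "\<tau> \<in> {t..(t + b) / 2}" for \<tau>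
      using that t by (intro stationary) auto
    show "0 \<le> u x \<tau>" if "\<tau> \<in> {t..(t + b) / 2}" "x \<in> {0..s 0}" for x \<tau>
      using that t by (intro nonneg) auto
    show "ux 0 \<tau> \<le> 0" "ux (s 0) \<tau> = 0" if "\<tau> \<in> {t..(t + b) / 2}" for \<tau>
      using that t by (auto intro!: inflow front)
  qed (use t x s0 in auto)
  show "ux 0 t = 0" if t: "t \<in> {0<..<b}" for t
  proof (rule ccontr)
    assume "ux 0 t \<noteq> 0"
    then have "ux 0 t < 0"
      using inflow[of t] t by auto
    moreover have "((\<lambda>x. u x t) has_real_derivative ux 0 t) (at 0 within {0..s 0})"
      using u_deriv_x[of t 0] stationary[of t] t s0 by auto
    ultimately obtain d where d: "d > 0" "\<And>h. 0 < h \<Longrightarrow> 0 + h \<in> {0..s 0} \<Longrightarrow> h < d \<Longrightarrow> u (0 + h) t < u 0 t"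
      using has_real_derivative_neg_dec_right by blast
    define h where "h = min d (s 0) / 2"
    have "0 < h" "h < d" "h \<le> s 0"
      using d(1) s0 by (auto simp: h_def)
    then show False
      using d(2)[of h] zero[OF t, of h] zero[OF t, of 0] by auto
  qed
  show "u x 0 = 0" if x: "x \<in> {0..s 0}" for x
  proof (rule continuous_constant_on_closure[where S = "{0<..<b}" and f = "\<lambda>t. u x t"])
    have "continuous_on {0..b} (\<lambda>t. u x t)"
    proof (rule continuous_on_compose_pair[OF u_cont])
      show "(x, t) \<in> {(x, t). 0 \<le> t \<and> 0 \<le> x \<and> x \<le> s t}" if "t \<in> {0..b}" for t
        using that x stationary[OF that] by auto
    qed (intro continuous_on_id continuous_on_const)+
    then show "continuous_on (closure {0<..<b}) (\<lambda>t. u x t)"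
      using b by simp
  qed (use b zero x in auto)
qed

end

lemma stefan_plant_imp_flow:
  assumes pos: "0 < \<alpha>" "0 < \<beta>" "0 < \<epsilon>"
    and plant: "stefan_plant \<alpha> k \<beta> \<epsilon> Tm qc T s"
  obtains Tx Txx Tt where "stefan_flow \<alpha> s (time_deriv s) (\<lambda>x t. T x t - Tm) Tx Txx Tt \<beta> \<epsilon>"
    and "\<And>t. 0 < t \<Longrightarrow> - k * Tx 0 t = qc t"
proof -
  obtain Tx Txx Tt where raw:
    "\<forall>t>0. \<forall>x\<in>{0..s t}. ((\<lambda>\<xi>. T \<xi> t) has_real_derivative Tx x t) (at x within {0..s t})"
    "continuous_on {(x, t). 0 < t \<and> 0 \<le> x \<and> x \<le> s t} (\<lambda>(x, t). Tx x t)"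
    "\<forall>t>0. \<forall>x\<in>{0<..<s t}. ((\<lambda>\<xi>. Tx \<xi> t) has_real_derivative Txx x t) (at x) \<and>
      ((\<lambda>\<tau>. T x \<tau>) has_real_derivative Tt x t) (at t)"
    "continuous_on {(x, t). 0 < t \<and> 0 < x \<and> x < s t} (\<lambda>(x, t). Tt x t)"
    "\<forall>t>0. \<forall>x\<in>{0<..<s t}. Tt x t = \<alpha> * Txx x t"
    "\<forall>t>0. - k * Tx 0 t = qc t" "\<forall>t>0. T (s t) t = Tm"
    "\<forall>t>0. \<epsilon> * time_deriv (time_deriv s) t = - time_deriv s t - \<beta> * Tx (s t) t"
    using plant unfolding stefan_plant_def by (elim conjE exE) (rule that, assumption+)
  note T = raw(1)[rule_format] raw(2) conjunct1[OF raw(3)[rule_format]]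
    conjunct2[OF raw(3)[rule_format]] raw(4) raw(5)[rule_format] raw(6)[rule_format]
    raw(7)[rule_format] raw(8)[rule_format]
  have s: "s differentiable_on {0..}" "continuous_on {0..} (time_deriv s)"
    "time_deriv s differentiable_on {0<..}"
    "continuous_on {(x, t). 0 \<le> t \<and> 0 \<le> x \<and> x \<le> s t} (\<lambda>(x, t). T x t)"
    using plant unfolding stefan_plant_def by blast+
  have "stefan_flow \<alpha> s (time_deriv s) (\<lambda>x t. T x t - Tm) Tx Txx Tt \<beta> \<epsilon>"
  proof
    show "continuous_on {0..} s"
      by (rule differentiable_imp_continuous_on[OF s(1)])
    show "(s has_real_derivative time_deriv s t) (at t)" if "0 < t" for t
      using has_time_deriv[OF s(1), of t] that by (simp add: at_within_nonneg_eq_at)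
    show "continuous_on {0<..} (time_deriv s)"
      by (rule continuous_on_subset[OF s(2)]) auto
    show "continuous_on {(x, t). 0 \<le> t \<and> 0 \<le> x \<and> x \<le> s t} (\<lambda>(x, t). T x t - Tm)"
      using s(4) by (auto simp: case_prod_unfold intro!: continuous_intros)
    show "((\<lambda>\<xi>. T \<xi> t - Tm) has_real_derivative Tx x t) (at x within {0..s t})"
      if "0 < t" "x \<in> {0..s t}" for x t
      using T(1)[OF that] by (auto intro!: derivative_eq_intros)
    show "((\<lambda>\<tau>. T x \<tau> - Tm) has_real_derivative Tt x t) (at t)"
      if "0 < t" "x \<in> {0<..<s t}" for x t
      using T(4)[OF that] by (auto intro!: derivative_eq_intros)
    show "(time_deriv s has_real_derivative (- time_deriv s t - \<beta> * Tx (s t) t) / \<epsilon>) (at t)"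
      if "0 < t" for t
    proof -
      have "time_deriv (time_deriv s) t = (- time_deriv s t - \<beta> * Tx (s t) t) / \<epsilon>"
        using T(9)[OF that] pos by (simp add: eq_divide_eq mult.commute)
      then show ?thesis
        using has_time_deriv_at[OF s(3) that] by simp
    qed
  qed (fact T s pos | simp add: T(6,8))+
  then show ?thesis
    using T(7) by (rule that)
qed

lemma traj_energy_continuous:
  assumes "0 < \<alpha>" "0 < \<beta>" "0 < \<epsilon>" "stefan_plant \<alpha> k \<beta> \<epsilon> Tm qc T s"
    and "P \<subseteq> {0..}" "\<And>t. t \<in> P \<Longrightarrow> 0 < s t"
  shows "continuous_on P (traj_energy \<alpha> k \<beta> \<epsilon> Tm T s)"
proof -
  obtain Tx Txx Tt where "stefan_flow \<alpha> s (time_deriv s) (\<lambda>x t. T x t - Tm) Tx Txx Tt \<beta> \<epsilon>"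
    by (rule stefan_plant_imp_flow[OF assms(1-4)])
  then interpret stefan_flow \<alpha> s "time_deriv s" "\<lambda>x t. T x t - Tm" Tx Txx Tt \<beta> \<epsilon> .
  show ?thesis
    using energy_continuous[OF assms(5,6), of k] by (simp add: traj_energy_def[abs_def] energy_def)
qed

lemma traj_energy_deriv:
  assumes "0 < \<alpha>" "0 < \<beta>" "0 < \<epsilon>" "stefan_plant \<alpha> k \<beta> \<epsilon> Tm qc T s" "0 < t" "0 < s t"
  shows "(traj_energy \<alpha> k \<beta> \<epsilon> Tm T s has_real_derivative qc t) (at t)"
proof -
  obtain Tx Txx Tt where "stefan_flow \<alpha> s (time_deriv s) (\<lambda>x t. T x t - Tm) Tx Txx Tt \<beta> \<epsilon>"
    and qc: "\<And>t. 0 < t \<Longrightarrow> - k * Tx 0 t = qc t"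
    by (rule stefan_plant_imp_flow[OF assms(1-4)]) (rule that)
  then interpret stefan_flow \<alpha> s "time_deriv s" "\<lambda>x t. T x t - Tm" Tx Txx Tt \<beta> \<epsilon> by blast
  show ?thesis
    using energy_deriv[OF assms(5,6), of k] qc[OF assms(5)]
    by (simp add: traj_energy_def[abs_def] energy_def)
qed

section \<open>Tracking the reference energy\<close>

text \<open>Plant and reference both obey the energy balance, so the feedback term turns the energy error
  \<open>D\<close> into a solution of \<open>D' = - c * D\<close>.\<close>
lemma closed_loop_energy_error:
  assumes pos: "0 < \<alpha>" "0 < \<beta>" "0 < \<epsilon>"
    and ref: "stefan_plant \<alpha> k \<beta> \<epsilon> Tm qr Tr sr" "\<And>t. 0 \<le> t \<Longrightarrow> 0 < sr t"
    and loop: "stefan_plant \<alpha> k \<beta> \<epsilon> Tm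
      (\<lambda>t. qr t - c * (traj_energy \<alpha> k \<beta> \<epsilon> Tm T s t - traj_energy \<alpha> k \<beta> \<epsilon> Tm Tr sr t)) T s"
    and t: "0 \<le> t" "\<And>\<tau>. \<tau> \<in> {0..t} \<Longrightarrow> 0 < s \<tau>"
  shows "traj_energy \<alpha> k \<beta> \<epsilon> Tm T s t - traj_energy \<alpha> k \<beta> \<epsilon> Tm Tr sr t
    = (traj_energy \<alpha> k \<beta> \<epsilon> Tm T s 0 - traj_energy \<alpha> k \<beta> \<epsilon> Tm Tr sr 0) * exp (- c * t)"
proof (cases "t = 0")
  case False
  define D where "D \<tau> = traj_energy \<alpha> k \<beta> \<epsilon> Tm T s \<tau> - traj_energy \<alpha> k \<beta> \<epsilon> Tm Tr sr \<tau>" for \<tau>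
  have "exp (c * t) * D t = exp (c * 0) * D 0"
  proof (rule DERIV_isconst_end[where f = "\<lambda>\<tau>. exp (c * \<tau>) * D \<tau>"])
    show "continuous_on {0..t} (\<lambda>\<tau>. exp (c * \<tau>) * D \<tau>)"
      unfolding D_def
      by (intro continuous_intros traj_energy_continuous[OF pos loop] traj_energy_continuous[OF pos ref(1)])
        (use t ref(2) in auto)
    fix \<tau> assume \<tau>: "0 < \<tau>" "\<tau> < t"
    have "(D has_real_derivative (qr \<tau> - c * D \<tau>) - qr \<tau>) (at \<tau>)"
      unfolding D_def
      by (intro DERIV_diff traj_energy_deriv[OF pos loop] traj_energy_deriv[OF pos ref(1)])
        (use \<tau> t ref(2) in auto)
    then show "((\<lambda>\<tau>. exp (c * \<tau>) * D \<tau>) has_real_derivative 0) (at \<tau>)"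
      by (auto intro!: derivative_eq_intros simp: algebra_simps)
  qed (use t False in auto)
  then have "exp (- c * t) * (exp (c * t) * D t) = exp (- c * t) * D 0"
    by simp
  then show ?thesis
    by (simp add: D_def mult.assoc[symmetric] exp_add[symmetric] mult.commute)
qed simp

text \<open>Inserting the exponential energy error into the control gives the open-loop expression
  \<open>qr t - c * (E0 - Er 0) * exp (- c * t)\<close>; \<open>flux_bound\<close> says exactly that it is nonnegative, and
  strict inequality in \<open>flux_bound\<close> that it is positive. The upper bound on the front comes from the
  energy, whose temperature and velocity parts have become nonnegative.\<close>
theorem closed_loop_safety:
  assumes params: "0 < \<alpha>" "0 < k" "0 < \<beta>" "0 < \<epsilon>" "0 < c"
    and s0: "0 < s0" and T0: "continuous_on {0..s0} T0" "\<And>x. x \<in> {0..s0} \<Longrightarrow> Tm \<le> T0 x"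
    and v0: "0 \<le> v0"
    and ref: "stefan_plant \<alpha> k \<beta> \<epsilon> Tm qr Tr sr" "\<And>t. 0 \<le> t \<Longrightarrow> 0 < sr t"
    and Er: "Er = traj_energy \<alpha> k \<beta> \<epsilon> Tm Tr sr" and E0: "E0 = energy \<alpha> k \<beta> \<epsilon> Tm T0 s0 v0"
    and flux_bound: "\<And>t. 0 \<le> t \<Longrightarrow> E0 \<le> Er 0 + 1 / c * qr t * exp (c * t)"
    and energy_bound: "\<And>t. 0 \<le> t \<Longrightarrow> Er t + (E0 - Er 0) * exp (- c * t) < k / \<beta> * S"
    and loop: "stefan_plant \<alpha> k \<beta> \<epsilon> Tm (\<lambda>t. qr t - c * (traj_energy \<alpha> k \<beta> \<epsilon> Tm T s t - Er t)) T s"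
    and initial: "stefan_initial T0 s0 v0 T s"
  shows "\<And>x t. 0 \<le> t \<Longrightarrow> x \<in> {0..s t} \<Longrightarrow> Tm \<le> T x t"
    and "\<And>t. 0 < t \<Longrightarrow> (\<exists>x\<in>{0..s0}. T0 x \<noteq> Tm) \<or> v0 \<noteq> 0 \<or>
        (\<exists>\<tau>\<in>{0<..<t}. E0 < Er 0 + 1 / c * qr \<tau> * exp (c * \<tau>)) \<Longrightarrow> s0 < s t"
    and "\<And>t. 0 \<le> t \<Longrightarrow> s t < S"
    and "\<And>t. 0 \<le> t \<Longrightarrow> 0 \<le> time_deriv s t"
proof -
  have init: "s 0 = s0" "time_deriv s 0 = v0" "\<And>x. x \<in> {0<..s0} \<Longrightarrow> T x 0 = T0 x"
    using initial by (auto simp: stefan_initial_def)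
  define E where "E = traj_energy \<alpha> k \<beta> \<epsilon> Tm T s"
  have E_0: "E 0 = E0"
  proof -
    have "integral {0..s0} (\<lambda>x. T x 0 - Tm) = integral {0..s0} (\<lambda>x. T0 x - Tm)"
      \<comment> \<open>The initial condition says nothing at \<open>x = 0\<close>, a null set.\<close>
      by (rule integral_spike[of "{0}"]) (auto simp: init)
    then show ?thesis
      by (simp add: E_def E0 traj_energy_def energy_def init)
  qed
  obtain Tx Txx Tt where "stefan_flow \<alpha> s (time_deriv s) (\<lambda>x t. T x t - Tm) Tx Txx Tt \<beta> \<epsilon>"
    and "\<And>t. 0 < t \<Longrightarrow> - k * Tx 0 t = qr t - c * (traj_energy \<alpha> k \<beta> \<epsilon> Tm T s t - Er t)"
    by (rule stefan_plant_imp_flow[OF params(1,3,4) loop]) (rule that)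
  then interpret stefan_flow \<alpha> s "time_deriv s" "\<lambda>x t. T x t - Tm" Tx Txx Tt \<beta> \<epsilon>
    by blast
  have flux: "- k * Tx 0 t = qr t - c * (E t - Er t)" if "0 < t" for t
    using \<open>\<And>t. 0 < t \<Longrightarrow> - k * Tx 0 t = _ t\<close>[OF that] by (simp add: E_def)
  have error: "E t - Er t = (E0 - Er 0) * exp (- c * t)"
    if "0 \<le> t" "\<And>\<tau>. \<tau> \<in> {0..t} \<Longrightarrow> 0 < s \<tau>" for t
    using closed_loop_energy_error[OF params(1,3,4) ref loop[unfolded Er] that]
    by (simp add: E_def[symmetric] Er[symmetric] E_0)
  have qr_bound: "c * ((E0 - Er 0) * exp (- c * t)) \<le> qr t \<and>
      (E0 < Er 0 + 1 / c * qr t * exp (c * t) \<longrightarrow> c * ((E0 - Er 0) * exp (- c * t)) < qr t)"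
    if "0 \<le> t" for t
  proof -
    have "qr t - c * ((E0 - Er 0) * exp (- c * t))
        = (Er 0 + 1 / c * qr t * exp (c * t) - E0) * (c * exp (- c * t))"
      using params(5) by (simp add: field_simps flip: exp_add)
    moreover have "0 < c * exp (- c * t)"
      using params(5) by simp
    ultimately show ?thesis
      using flux_bound[OF that]
      by (smt (verit) mult_nonneg_nonneg mult_pos_pos)
  qed
  have inflow: "Tx 0 t \<le> 0" if "0 < t" "\<And>\<tau>. \<tau> \<in> {0..t} \<Longrightarrow> 0 < s \<tau>" for t
  proof -
    have "0 \<le> - k * Tx 0 t"
      using flux[OF that(1)] error[of t] qr_bound[of t] that by auto
    then show ?thesis
      using params(2) by (simp add: mult_le_0_iff)
  qed
  have u_init: "0 \<le> T x 0 - Tm" if "x \<in> {0<..s 0}" for x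
    using that init T0(2)[of x] by auto
  have s0': "0 < s 0" and v0': "0 \<le> time_deriv s 0"
    using init s0 v0 by auto
  have mono: "s 0 \<le> s t" "exp (- t / \<epsilon>) * time_deriv s 0 \<le> time_deriv s t"
    "\<forall>x\<in>{0..s t}. 0 \<le> T x t - Tm" if "0 \<le> t" for t
    using front_monotone[OF s0' v0' u_init inflow that] by blast+
  show nonneg: "Tm \<le> T x t" if "0 \<le> t" "x \<in> {0..s t}" for x t
    using mono(3)[OF that(1)] that by auto
  have s_ge: "s0 \<le> s t" if "0 \<le> t" for t
    using mono(1)[OF that] init by auto
  have s_pos: "0 < s t" if "0 \<le> t" for t
    using s_ge[OF that] s0 by simp
  have velocity: "exp (- t / \<epsilon>) * v0 \<le> time_deriv s t" if "0 \<le> t" for t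
    using mono(2)[OF that] init by auto
  show velocity_nonneg: "0 \<le> time_deriv s t" if "0 \<le> t" for t
    using velocity[OF that] v0 by (smt (verit) exp_ge_zero mult_nonneg_nonneg)
  show "s t < S" if t: "0 \<le> t" for t
  proof -
    have "k / \<beta> * s t \<le> E t"
    proof -
      have "continuous_on {0..s t} (\<lambda>x. T x t - Tm)"
        by (rule continuous_on_compose_pair[OF u_cont])
          (use t in \<open>auto intro: continuous_on_id continuous_on_const\<close>)
      then have "0 \<le> integral {0..s t} (\<lambda>x. T x t - Tm)"
        using nonneg[OF t] by (intro integral_nonneg integrable_continuous_real) auto
      then have "0 \<le> k / \<alpha> * integral {0..s t} (\<lambda>x. T x t - Tm)" "0 \<le> k / \<beta> * (\<epsilon> * time_deriv s t)"
        using params velocity_nonneg[OF t] by auto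
      then show ?thesis
        by (simp add: E_def traj_energy_def energy_def distrib_left)
    qed
    also have "E t < k / \<beta> * S"
      using error[OF t] s_pos energy_bound[OF t] by auto
    finally show ?thesis
      using params by (simp add: divide_less_cancel)
  qed
  show "s0 < s t" if t: "0 < t" and active: "(\<exists>x\<in>{0..s0}. T0 x \<noteq> Tm) \<or> v0 \<noteq> 0 \<or>
      (\<exists>\<tau>\<in>{0<..<t}. E0 < Er 0 + 1 / c * qr \<tau> * exp (c * \<tau>))" for t
  proof (rule ccontr)
    assume "\<not> s0 < s t"
    have s_cont_Icc: "continuous_on {a..b} s" if "0 \<le> a" for a b
      using that by (intro continuous_on_subset[OF s_cont]) auto
    have s_mono: "s a \<le> s b" if "0 \<le> a" "a \<le> b" for a b
    proof (rule DERIV_nonneg_imp_increasing_open[OF that(2)])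
      fix t assume "a < t" "t < b"
      then have "0 < t"
        using that by simp
      then show "\<exists>y. (s has_real_derivative y) (at t) \<and> 0 \<le> y"
        using s_deriv[of t] velocity_nonneg[of t] by auto
    qed (rule s_cont_Icc[OF that(1)])
    have stationary: "s \<tau> = s 0" if "\<tau> \<in> {0..t}" for \<tau>
      using s_mono[of \<tau> t] s_ge[of \<tau>] that \<open>\<not> s0 < s t\<close> init(1) by auto
    have "v0 = 0"
    proof (rule ccontr)
      assume "v0 \<noteq> 0"
      have "s 0 < s t"
      proof (rule DERIV_pos_imp_increasing_open[OF t])
        fix \<tau> assume "0 < \<tau>" "\<tau> < t"
        moreover have "0 < exp (- \<tau> / \<epsilon>) * v0"
          using v0 \<open>v0 \<noteq> 0\<close> by simp
        ultimately show "\<exists>y. (s has_real_derivative y) (at \<tau>) \<and> 0 < y"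
          using s_deriv[of \<tau>] velocity[of \<tau>] by (intro exI[of _ "time_deriv s \<tau>"]) auto
      qed (rule s_cont_Icc, simp)
      then show False
        using stationary[of t] t by simp
    qed
    have nonneg': "0 \<le> T x \<tau> - Tm" if "\<tau> \<in> {0..t}" "x \<in> {0..s 0}" for x \<tau>
      using nonneg[of \<tau> x] that stationary[OF that(1)] by auto
    have inflow': "Tx 0 \<tau> \<le> 0" if "\<tau> \<in> {0<..t}" for \<tau>
      using that by (intro inflow s_pos) auto
    have equilibrium: "\<forall>\<tau>\<in>{0<..<t}. Tx 0 \<tau> = 0" "\<forall>x\<in>{0..s 0}. T x 0 - Tm = 0"
      using stationary_front_imp_equilibrium[OF t s0' stationary nonneg' inflow'] by blast+
    have T0_eq: "T0 x = Tm" if x: "x \<in> {0..s0}" for x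
    proof (rule continuous_constant_on_closure[where S = "{0<..s0}" and f = T0])
      show "continuous_on (closure {0<..s0}) T0"
        using T0(1) s0 by simp
      show "T0 x = Tm" if "x \<in> {0<..s0}" for x
        using equilibrium(2) init that by auto
    qed (use x s0 in auto)
    have "\<not> E0 < Er 0 + 1 / c * qr \<tau> * exp (c * \<tau>)" if \<tau>: "\<tau> \<in> {0<..<t}" for \<tau>
    proof -
      have "qr \<tau> - c * (E \<tau> - Er \<tau>) = 0"
        using flux[of \<tau>] equilibrium(1) \<tau> by simp
      then show ?thesis
        using error[of \<tau>] s_pos qr_bound[of \<tau>] \<tau> by auto
    qed
    then show False
      using active \<open>v0 = 0\<close> T0_eq by blast
  qed
qed

section \<open>The Gevrey reference series\<close>

lemma time_deriv_eqI:
  assumes "(f has_real_derivative D) (at t within {0..})" "0 \<le> t"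
  shows "time_deriv f t = D"
proof -
  have "t islimpt {t<..<t + 1}"
    by (rule islimpt_greaterThanLessThan1) simp
  then have "t islimpt {0..}"
    by (rule islimpt_subset) (use assms(2) in auto)
  then have "at t within {0..} \<noteq> bot"
    by (simp add: trivial_limit_within)
  then show ?thesis
    unfolding time_deriv_def
    by (rule vector_derivative_within)
      (use assms(1) in \<open>simp add: has_real_derivative_iff_has_vector_derivative\<close>)
qed

text \<open>The inductive step of the general Leibniz rule, with \<open>P j m\<close> standing for the \<open>j\<close>-th
  derivative of one factor times the \<open>m\<close>-th derivative of the other.\<close>
lemma sum_binomial_Suc:
  fixes P :: "nat \<Rightarrow> nat \<Rightarrow> real"
  shows "(\<Sum>j\<le>Suc l. real (Suc l choose j) * P j (Suc l - j))
    = (\<Sum>j\<le>l. real (l choose j) * (P (Suc j) (l - j) + P j (Suc l - j)))"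
proof -
  have "(\<Sum>j\<le>l. real (l choose j) * P j (Suc l - j)) = (\<Sum>j\<le>Suc l. real (l choose j) * P j (Suc l - j))"
    by simp
  also have "\<dots> = P 0 (Suc l) + (\<Sum>j\<le>l. real (l choose Suc j) * P (Suc j) (l - j))"
    by (subst sum.atMost_Suc_shift) simp
  finally have shift: "(\<Sum>j\<le>l. real (l choose j) * P j (Suc l - j))
      = P 0 (Suc l) + (\<Sum>j\<le>l. real (l choose Suc j) * P (Suc j) (l - j))" .
  have "(\<Sum>j\<le>Suc l. real (Suc l choose j) * P j (Suc l - j))
      = P 0 (Suc l) + (\<Sum>j\<le>l. real (Suc l choose Suc j) * P (Suc j) (l - j))"
    by (subst sum.atMost_Suc_shift) simp
  then show ?thesis
    using shift by (simp add: sum.distrib distrib_left distrib_right)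
qed

text \<open>The estimate behind the closure of Gevrey bounds under products. By Vandermonde's identity
  \<open>(l choose j)\<^sup>2 \<le> (2 * l choose 2 * j)\<close>, and \<open>(fact j)\<^sup>2 \<le> fact (2 * j)\<close>; so the squares of the first
  two factors times the third stay below \<open>(N choose 2 * j) * fact (2 * j) * fact (N - 2 * j) = fact N\<close> with
  \<open>N = n + 2 * l\<close>. The power \<open>\<mu>\<close> of this inequality suffices because
  \<open>l choose j \<le> (l choose j) powr (2 * \<mu>)\<close> for \<open>\<mu> \<ge> 1/2\<close>.\<close>
lemma binomial_gevrey_le:
  fixes \<mu> :: real
  assumes j: "j \<le> l" and \<mu>: "1/2 \<le> \<mu>"
  shows "real (l choose j) * (fact j powr (2 * \<mu>) * fact (n + 2 * (l - j)) powr \<mu>)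
    \<le> fact (n + 2 * l) powr \<mu>"
proof -
  have "(l choose j) * (l choose j) = (l choose j) * (l choose (2 * j - j))"
    by simp
  also have "\<dots> \<le> (\<Sum>k\<le>2 * j. (l choose k) * (l choose (2 * j - k)))"
    by (rule member_le_sum[where f = "\<lambda>k. (l choose k) * (l choose (2 * j - k))"]) auto
  also have "\<dots> = (l + l) choose (2 * j)"
    by (rule vandermonde)
  also have "\<dots> \<le> (n + 2 * l) choose (2 * j)"
    by (rule binomial_right_mono) simp
  finally have choose: "(l choose j) * (l choose j) \<le> (n + 2 * l) choose (2 * j)" .
  have "fact j * fact j \<le> (fact (2 * j) :: nat)"
    using dvd_imp_le[OF fact_fact_dvd_fact[of j j, where ?'a = nat]] by (simp add: mult_2)
  then have "((l choose j) * (l choose j)) * (fact j * fact j) * fact (n + 2 * (l - j))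
      \<le> ((n + 2 * l) choose (2 * j)) * fact (2 * j) * (fact (n + 2 * (l - j)) :: nat)"
    using choose by (intro mult_mono) auto
  also have "n + 2 * (l - j) = n + 2 * l - 2 * j"
    using j by simp
  also have "((n + 2 * l) choose (2 * j)) * fact (2 * j) * fact (n + 2 * l - 2 * j) = (fact (n + 2 * l) :: nat)"
    using binomial_fact_lemma[of "2 * j" "n + 2 * l"] j by (simp add: algebra_simps)
  finally have "real (((l choose j) * (l choose j)) * (fact j * fact j) * fact (n + 2 * l - 2 * j))
      \<le> real (fact (n + 2 * l))"
    by (rule of_nat_mono)
  then have nat_le: "(real (l choose j) * real (l choose j)) * (fact j * fact j) * fact (n + 2 * (l - j))
      \<le> (fact (n + 2 * l) :: real)"
    using \<open>n + 2 * (l - j) = n + 2 * l - 2 * j\<close> by simp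
  have one: "1 \<le> real (l choose j)"
    using j by (simp add: Suc_leI)
  have sq: "(x * x) powr \<mu> = x powr (2 * \<mu>)" if "0 < x" for x :: real
  proof -
    have "x powr (2 * \<mu>) = x powr \<mu> * x powr \<mu>"
      by (simp flip: powr_add)
    then show ?thesis
      using that by (simp only: powr_mult)
  qed
  have "real (l choose j) powr 1 \<le> real (l choose j) powr (2 * \<mu>)"
    using one \<mu> by (intro powr_mono) auto
  then have "real (l choose j) * (fact j powr (2 * \<mu>) * fact (n + 2 * (l - j)) powr \<mu>)
      \<le> real (l choose j) powr (2 * \<mu>) * (fact j powr (2 * \<mu>) * fact (n + 2 * (l - j)) powr \<mu>)"
    using one by (intro mult_right_mono) auto
  also have "\<dots> = ((real (l choose j) * real (l choose j)) * (fact j * fact j) * fact (n + 2 * (l - j))) powr \<mu>"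
  proof -
    have "0 < real (l choose j)"
      using one by linarith
    then show ?thesis
      by (simp only: sq[symmetric] sq[OF fact_gt_zero, symmetric] powr_mult mult.assoc)
  qed
  also have "\<dots> \<le> fact (n + 2 * l) powr \<mu>"
    using nat_le \<mu> by (intro powr_mono2) auto
  finally show ?thesis .
qed

lemma summable_gevrey:
  fixes \<mu> c :: real
  assumes \<mu>: "0 \<le> \<mu>" "\<mu> < 1" and c: "0 \<le> c"
  shows "summable (\<lambda>n. c ^ n * fact (n + p) powr \<mu> / fact n)"
proof -
  define h where "h n = c * (real (p + 1) powr \<mu> * real (n + 1) powr (\<mu> - 1))" for n
  have "filterlim (\<lambda>n. real (n + 1)) at_top sequentially"
    using filterlim_compose[OF filterlim_real_sequentially filterlim_Suc] by simp
  then have "(\<lambda>n. real (n + 1) powr (\<mu> - 1)) \<longlonglongrightarrow> 0"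
    using \<mu> by (intro tendsto_neg_powr) auto
  then have "h \<longlonglongrightarrow> c * (real (p + 1) powr \<mu> * 0)"
    unfolding h_def by (intro tendsto_intros)
  then have "eventually (\<lambda>n. h n < 1/2) sequentially"
    using order_tendstoD(2)[of h 0 sequentially "1/2"] by simp
  then obtain N where N: "\<And>n. n \<ge> N \<Longrightarrow> h n < 1/2"
    unfolding eventually_sequentially by blast
  show ?thesis
  proof (rule summable_ratio_test[where c = "1/2" and N = N])
    fix n assume n: "n \<ge> N"
    have "fact (Suc n + p) powr \<mu> = (real (n + 1 + p) * fact (n + p)) powr \<mu>"
      by (simp add: add.commute)
    also have "\<dots> \<le> (real (p + 1) * real (n + 1) * fact (n + p)) powr \<mu>"
    proof (intro powr_mono2 mult_right_mono \<mu>)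
      have "n + 1 + p \<le> (p + 1) * (n + 1)"
        by simp
      then show "real (n + 1 + p) \<le> real (p + 1) * real (n + 1)"
        by (metis of_nat_le_iff of_nat_mult)
    qed auto
    also have "\<dots> = real (p + 1) powr \<mu> * real (n + 1) powr \<mu> * fact (n + p) powr \<mu>"
      by (simp only: powr_mult)
    finally have "c ^ Suc n * fact (Suc n + p) powr \<mu> / fact (Suc n)
        \<le> c ^ Suc n * (real (p + 1) powr \<mu> * real (n + 1) powr \<mu> * fact (n + p) powr \<mu>) / fact (Suc n)"
      using c by (intro divide_right_mono mult_left_mono) auto
    also have "real (n + 1) powr \<mu> = real (n + 1) powr (\<mu> - 1) * real (n + 1)"
      using powr_add[of "real (n + 1)" "\<mu> - 1" 1] by simp
    also have "c ^ Suc n * (real (p + 1) powr \<mu> * (real (n + 1) powr (\<mu> - 1) * real (n + 1))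
        * fact (n + p) powr \<mu>) / fact (Suc n) = h n * (c ^ n * fact (n + p) powr \<mu> / fact n)"
    proof -
      have "fact (Suc n) = real (n + 1) * fact n"
        by simp
      then show ?thesis
        unfolding h_def by (simp only:) (simp add: field_simps del: of_nat_Suc of_nat_add)
    qed
    also have "\<dots> \<le> 1/2 * (c ^ n * fact (n + p) powr \<mu> / fact n)"
      using N[OF n] c by (intro mult_right_mono) auto
    finally show "norm (c ^ Suc n * fact (Suc n + p) powr \<mu> / fact (Suc n))
        \<le> 1/2 * norm (c ^ n * fact (n + p) powr \<mu> / fact n)"
      using c by simp
  qed simp
qed

text \<open>\<open>coeff_jet n l\<close> is the \<open>l\<close>-th time derivative of the \<open>n\<close>-th coefficient, written
  out by Leibniz' rule in terms of the iterated derivatives of the reference. Having all these derivatives in one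
  explicit recursion, instead of iterating \<open>time_deriv\<close> on the coefficients, is what allows a bound by
  induction on \<open>n\<close>.\<close>
fun coeff_jet ::
  "real \<Rightarrow> real \<Rightarrow> real \<Rightarrow> (real \<Rightarrow> real) \<Rightarrow> nat \<Rightarrow> nat \<Rightarrow> real \<Rightarrow> real" where
  "coeff_jet \<alpha> \<beta> \<epsilon> sr 0 l t = 0"
| "coeff_jet \<alpha> \<beta> \<epsilon> sr (Suc 0) l t =
     - (1 / \<beta>) * (\<epsilon> * (time_deriv ^^ (l + 2)) sr t + (time_deriv ^^ (l + 1)) sr t)"
| "coeff_jet \<alpha> \<beta> \<epsilon> sr (Suc (Suc n)) l t =
     (1 / \<alpha>) * (coeff_jet \<alpha> \<beta> \<epsilon> sr n (Suc l) t
       - (\<Sum>j\<le>l. real (l choose j) * ((time_deriv ^^ (j + 1)) sr t * coeff_jet \<alpha> \<beta> \<epsilon> sr (Suc n) (l - j) t)))"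

lemma time_deriv_iterate_deriv:
  assumes "smooth_in_time f" "0 \<le> t"
  shows "((time_deriv ^^ m) f has_real_derivative (time_deriv ^^ Suc m) f t) (at t within {0..})"
  using has_time_deriv[of "(time_deriv ^^ m) f" t] assms by (simp add: smooth_in_time_def)

lemma coeff_jet_deriv:
  assumes sr: "smooth_in_time sr" and t: "0 \<le> t"
  shows "(coeff_jet \<alpha> \<beta> \<epsilon> sr n l has_real_derivative coeff_jet \<alpha> \<beta> \<epsilon> sr n (Suc l) t) (at t within {0..})"
proof (induction n arbitrary: l rule: induct_nat_012)
  case 0
  show ?case
    by simp
next
  case 1
  show ?case
    using DERIV_cmult[OF DERIV_add[OF DERIV_cmult[OF time_deriv_iterate_deriv[OF sr t, of "l + 2"]]
          time_deriv_iterate_deriv[OF sr t, of "l + 1"]], of "- (1 / \<beta>)" \<epsilon>]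
    unfolding coeff_jet.simps by simp
next
  case (ge2 n)
  define P where "P j m t = (time_deriv ^^ (j + 1)) sr t * coeff_jet \<alpha> \<beta> \<epsilon> sr (Suc n) m t" for j m t
  have P: "(P j m has_real_derivative P (Suc j) m t + P j (Suc m) t) (at t within {0..})" for j m
    unfolding P_def
    using DERIV_mult[OF time_deriv_iterate_deriv[OF sr t, of "j + 1"] ge2(2)[of m]]
    by (simp add: algebra_simps)
  have "((\<lambda>t. \<Sum>j\<le>l. real (l choose j) * P j (l - j) t) has_real_derivative
      (\<Sum>j\<le>l. real (l choose j) * (P (Suc j) (l - j) t + P j (Suc (l - j)) t))) (at t within {0..})"
    by (intro DERIV_sum DERIV_cmult P)
  also have "(\<Sum>j\<le>l. real (l choose j) * (P (Suc j) (l - j) t + P j (Suc (l - j)) t))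
      = (\<Sum>j\<le>Suc l. real (Suc l choose j) * P j (Suc l - j) t)"
    unfolding sum_binomial_Suc[of l "\<lambda>j m. P j m t"] by (simp add: Suc_diff_le)
  finally have sum: "((\<lambda>t. \<Sum>j\<le>l. real (l choose j) * P j (l - j) t) has_real_derivative
      (\<Sum>j\<le>Suc l. real (Suc l choose j) * P j (Suc l - j) t)) (at t within {0..})" .
  show ?case
    using DERIV_cmult[OF DERIV_diff[OF ge2(1)[of "Suc l"] sum], of "1 / \<alpha>"]
    unfolding P_def coeff_jet.simps .
qed

lemma ref_coeff_eq_coeff_jet:
  assumes sr: "smooth_in_time sr" and t: "0 \<le> t"
  shows "ref_coeff \<alpha> \<beta> \<epsilon> sr n t = coeff_jet \<alpha> \<beta> \<epsilon> sr n 0 t"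
  using t
proof (induction n arbitrary: t rule: induct_nat_012)
  case (ge2 n)
  have "(ref_coeff \<alpha> \<beta> \<epsilon> sr n has_real_derivative coeff_jet \<alpha> \<beta> \<epsilon> sr n (Suc 0) t) (at t within {0..})"
    by (rule has_field_derivative_transform_within[OF coeff_jet_deriv[OF sr ge2(3), of _ _ _ n 0] zero_less_one])
      (use ge2 in auto)
  then have "time_deriv (ref_coeff \<alpha> \<beta> \<epsilon> sr n) t = coeff_jet \<alpha> \<beta> \<epsilon> sr n (Suc 0) t"
    using ge2(3) by (rule time_deriv_eqI)
  then show ?case
    using ge2(2)[OF ge2(3)] by simp
qed simp_all

text \<open>A reference of Gevrey order \<open>2 * \<mu> < 2\<close>. Orders below one are also of order one, which is why
  \<open>\<mu> \<ge> 1/2\<close> is no loss.\<close>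
locale gevrey_reference =
  fixes \<alpha> \<beta> \<epsilon> M R \<mu> Z :: real and sr :: "real \<Rightarrow> real"
  assumes pos: "0 < \<alpha>" "0 < \<beta>" "0 < \<epsilon>" "0 < M" "0 < R"
    and \<mu>: "1/2 \<le> \<mu>" "\<mu> < 1"
    and smooth: "smooth_in_time sr"
    and gevrey: "\<And>m t. 0 \<le> t \<Longrightarrow> \<bar>(time_deriv ^^ (m + 1)) sr t\<bar> \<le> M * fact m powr (2 * \<mu>) / R ^ m"
    and sr_range: "\<And>t. 0 \<le> t \<Longrightarrow> 0 < sr t" "\<And>t. 0 \<le> t \<Longrightarrow> sr t \<le> Z"
begin

abbreviation jet :: "nat \<Rightarrow> nat \<Rightarrow> real \<Rightarrow> real" where
  "jet \<equiv> coeff_jet \<alpha> \<beta> \<epsilon> sr"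

text \<open>Giving up a factor four in the radius \<open>R\<close> gains \<open>(1/4) ^ j\<close>. In the first bound this keeps the
  sum in Leibniz' rule bounded uniformly in its length; in the second it absorbs the factor
  \<open>(j + 1) powr (2 * \<mu>)\<close> that an additional derivative costs.\<close>
lemma gevrey_quarter:
  assumes t: "0 \<le> t"
  shows "\<bar>(time_deriv ^^ (j + 1)) sr t\<bar> \<le> M * fact j powr (2 * \<mu>) * (1/4) ^ j / (R/4) ^ j"
    and "\<bar>(time_deriv ^^ (j + 2)) sr t\<bar> \<le> (M / R) * fact j powr (2 * \<mu>) / (R/4) ^ j"
proof -
  have quarter: "(1/4) ^ j / (R/4) ^ j = 1 / R ^ j"
    using pos by (simp add: power_divide field_simps)
  then show "\<bar>(time_deriv ^^ (j + 1)) sr t\<bar> \<le> M * fact j powr (2 * \<mu>) * (1/4) ^ j / (R/4) ^ j"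
    using gevrey[OF t, of j] by (metis times_divide_eq_right mult.right_neutral)
  have "(real j + 1) powr (2 * \<mu>) \<le> (real j + 1) powr 2"
    using \<mu> by (intro powr_mono) auto
  also have "\<dots> = (real j + 1) ^ 2"
    by simp
  also have "\<dots> \<le> (2 ^ j) ^ 2"
    using less_exp[of j] by (intro power_mono) (metis Suc_leI of_nat_Suc of_nat_le_iff of_nat_numeral of_nat_power add.commute, simp)
  also have "\<dots> = 4 ^ j"
    by (simp flip: power_mult power_mult_distrib add: power2_eq_square)
  finally have "fact (j + 1) powr (2 * \<mu>) \<le> 4 ^ j * fact j powr (2 * \<mu>)"
    by (simp add: powr_mult mult_right_mono add.commute)
  then have "M * fact (j + 1) powr (2 * \<mu>) / R ^ (j + 1) \<le> M * (4 ^ j * fact j powr (2 * \<mu>)) / R ^ (j + 1)"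
    using pos by (intro divide_right_mono mult_left_mono) auto
  also have "\<dots> = (M / R) * fact j powr (2 * \<mu>) / (R/4) ^ j"
    using pos by (simp add: power_divide field_simps)
  finally show "\<bar>(time_deriv ^^ (j + 2)) sr t\<bar> \<le> (M / R) * fact j powr (2 * \<mu>) / (R/4) ^ j"
    using gevrey[OF t, of "j + 1"] by simp
qed

definition growth_const :: real where
  "growth_const = (M / \<beta>) * (\<epsilon> / R + 1)"

definition growth_rate :: real where
  "growth_rate = max 1 ((1 / (R/4) + 2 * M) / \<alpha>)"

lemma growth_pos: "0 < growth_const" "1 \<le> growth_rate"
  using pos by (auto simp: growth_const_def growth_rate_def
      intro!: divide_pos_pos mult_pos_pos add_pos_pos)

text \<open>Two coefficients cost one time derivative, and \<open>n + 2 * l\<close> is invariant under that exchange.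
  The convolution term of the recursion is controlled by \<open>binomial_gevrey_le\<close> and \<open>gevrey_quarter\<close>, and
  \<open>growth_rate\<close> is chosen to absorb the constants of one step. For \<open>l = 0\<close> the bound is
  \<open>fact n powr \<mu>\<close> up to a geometric factor, so that the Taylor series, with its \<open>1 / fact n\<close>, converges everywhere.\<close>
lemma coeff_jet_bound:
  assumes t: "0 \<le> t"
  shows "\<bar>jet n l t\<bar> \<le> growth_const * growth_rate ^ n / (R/4) ^ l * fact (n + 2 * l) powr \<mu>"
proof (induction n arbitrary: l rule: induct_nat_012)
  case 0
  show ?case
    using growth_pos pos by simp
next
  case 1
  have "fact l powr (2 * \<mu>) = (fact l * fact l) powr \<mu>"
    unfolding powr_mult by (simp flip: powr_add)
  also have "\<dots> \<le> fact (Suc 0 + 2 * l) powr \<mu>"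
  proof (intro powr_mono2)
    have "fact l * fact l \<le> (fact (l + l) :: nat)"
      by (rule dvd_imp_le[OF fact_fact_dvd_fact]) simp
    also have "\<dots> \<le> fact (Suc 0 + 2 * l)"
      by (rule fact_mono) simp
    finally show "fact l * fact l \<le> (fact (Suc 0 + 2 * l) :: real)"
      by (metis of_nat_fact of_nat_le_iff of_nat_mult)
  qed (use \<mu> in auto)
  finally have fact_le: "fact l powr (2 * \<mu>) \<le> fact (Suc 0 + 2 * l) powr \<mu>" .
  have "\<bar>(time_deriv ^^ (l + 1)) sr t\<bar> \<le> M * fact l powr (2 * \<mu>) * (1/4) ^ l / (R/4) ^ l"
    by (rule gevrey_quarter(1)[OF t])
  also have "\<dots> \<le> M * fact l powr (2 * \<mu>) * 1 / (R/4) ^ l"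
    using pos by (intro divide_right_mono mult_left_mono) (auto simp: power_le_one)
  finally have d1: "\<bar>(time_deriv ^^ (l + 1)) sr t\<bar> \<le> M * fact l powr (2 * \<mu>) / (R/4) ^ l"
    by simp
  have "\<bar>jet (Suc 0) l t\<bar>
      = (1 / \<beta>) * \<bar>\<epsilon> * (time_deriv ^^ (l + 2)) sr t + (time_deriv ^^ (l + 1)) sr t\<bar>"
    using pos by (simp add: abs_mult del: funpow.simps)
  also have "\<dots> \<le> (1 / \<beta>) * (\<epsilon> * ((M / R) * fact l powr (2 * \<mu>) / (R/4) ^ l)
      + M * fact l powr (2 * \<mu>) / (R/4) ^ l)"
  proof (intro mult_left_mono order_trans[OF abs_triangle_ineq] add_mono d1)
    show "\<bar>\<epsilon> * (time_deriv ^^ (l + 2)) sr t\<bar> \<le> \<epsilon> * ((M / R) * fact l powr (2 * \<mu>) / (R/4) ^ l)"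
      unfolding abs_mult abs_of_pos[OF pos(3)]
      by (rule mult_left_mono[OF gevrey_quarter(2)[OF t]]) (use pos in simp)
  qed (use pos in auto)
  also have "\<dots> = growth_const / (R/4) ^ l * fact l powr (2 * \<mu>)"
    using pos by (simp add: growth_const_def field_simps)
  also have "\<dots> \<le> growth_const / (R/4) ^ l * fact (Suc 0 + 2 * l) powr \<mu>"
    using fact_le growth_pos pos by (intro mult_left_mono) auto
  also have "\<dots> \<le> growth_const * growth_rate ^ Suc 0 / (R/4) ^ l * fact (Suc 0 + 2 * l) powr \<mu>"
    using growth_pos pos by (intro mult_right_mono divide_right_mono) auto
  finally show ?case .
next
  case (ge2 n)
  define C where "C = growth_const * growth_rate ^ Suc n / (R/4) ^ l * fact (Suc (Suc n) + 2 * l) powr \<mu>"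
  have C: "0 \<le> C"
    using growth_pos pos by (simp add: C_def)
  have first: "\<bar>jet n (Suc l) t\<bar> \<le> C * (1 / (R/4))"
  proof -
    have "\<bar>jet n (Suc l) t\<bar> \<le> growth_const * growth_rate ^ n / (R/4) ^ Suc l * fact (n + 2 * Suc l) powr \<mu>"
      by (rule ge2)
    also have "\<dots> \<le> growth_const * growth_rate ^ Suc n / (R/4) ^ Suc l * fact (n + 2 * Suc l) powr \<mu>"
      using growth_pos pos by (intro mult_right_mono divide_right_mono mult_left_mono power_increasing) auto
    also have "\<dots> = C * (1 / (R/4))"
      using pos by (simp add: C_def mult_ac)
    finally show ?thesis .
  qed
  have convolution: "\<bar>real (l choose j) * ((time_deriv ^^ (j + 1)) sr t * jet (Suc n) (l - j) t)\<bar>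
      \<le> C * M * (1/4) ^ j" if j: "j \<le> l" for j
  proof -
    have "\<bar>real (l choose j) * ((time_deriv ^^ (j + 1)) sr t * jet (Suc n) (l - j) t)\<bar>
        = real (l choose j) * (\<bar>(time_deriv ^^ (j + 1)) sr t\<bar> * \<bar>jet (Suc n) (l - j) t\<bar>)"
      by (simp add: abs_mult del: funpow.simps)
    also have "\<dots> \<le> real (l choose j) * ((M * fact j powr (2 * \<mu>) * (1/4) ^ j / (R/4) ^ j) *
        (growth_const * growth_rate ^ Suc n / (R/4) ^ (l - j) * fact (Suc n + 2 * (l - j)) powr \<mu>))"
      by (intro mult_left_mono mult_mono gevrey_quarter(1)[OF t] ge2) (use pos in auto)
    also have "\<dots> = (M * (1/4) ^ j * growth_const * growth_rate ^ Suc n / ((R/4) ^ j * (R/4) ^ (l - j))) *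
        (real (l choose j) * (fact j powr (2 * \<mu>) * fact (Suc n + 2 * (l - j)) powr \<mu>))"
      by simp
    also have "(R/4) ^ j * (R/4) ^ (l - j) = (R/4) ^ l"
      using j by (simp flip: power_add)
    also have "(M * (1/4) ^ j * growth_const * growth_rate ^ Suc n / (R/4) ^ l) *
          (real (l choose j) * (fact j powr (2 * \<mu>) * fact (Suc n + 2 * (l - j)) powr \<mu>))
        \<le> (M * (1/4) ^ j * growth_const * growth_rate ^ Suc n / (R/4) ^ l) * fact (Suc (Suc n) + 2 * l) powr \<mu>"
    proof (intro mult_left_mono order_trans[OF binomial_gevrey_le[OF j \<mu>(1)]] powr_mono2)
      show "fact (Suc n + 2 * l) \<le> (fact (Suc (Suc n) + 2 * l) :: real)"
        by (rule fact_mono) simp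
    qed (use \<mu> pos growth_pos in auto)
    also have "\<dots> = C * M * (1/4) ^ j"
      by (simp add: C_def)
    finally show ?thesis .
  qed
  have "\<bar>\<Sum>j\<le>l. real (l choose j) * ((time_deriv ^^ (j + 1)) sr t * jet (Suc n) (l - j) t)\<bar>
      \<le> (\<Sum>j\<le>l. C * M * (1/4) ^ j)"
    by (rule order_trans[OF sum_abs sum_mono]) (use convolution in simp)
  also have "\<dots> = C * M * (\<Sum>j\<le>l. (1/4) ^ j)"
    by (simp add: sum_distrib_left)
  also have "\<dots> \<le> C * M * 2"
  proof (intro mult_left_mono)
    have "(\<Sum>j\<le>l. (1/4 :: real) ^ j) \<le> (\<Sum>j. (1/4) ^ j)"
      by (intro sum_le_suminf summable_geometric) auto
    also have "\<dots> \<le> 2"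
      by (simp add: suminf_geometric)
    finally show "(\<Sum>j\<le>l. (1/4 :: real) ^ j) \<le> 2" .
  qed (use C pos in auto)
  finally have second: "\<bar>\<Sum>j\<le>l. real (l choose j) * ((time_deriv ^^ (j + 1)) sr t * jet (Suc n) (l - j) t)\<bar>
      \<le> C * (2 * M)"
    by simp
  have "\<bar>jet (Suc (Suc n)) l t\<bar> = (1 / \<alpha>) * \<bar>jet n (Suc l) t
      - (\<Sum>j\<le>l. real (l choose j) * ((time_deriv ^^ (j + 1)) sr t * jet (Suc n) (l - j) t))\<bar>"
    unfolding coeff_jet.simps using pos by (simp only: abs_mult) simp
  also have "\<dots> \<le> (1 / \<alpha>) * (C * (1 / (R/4)) + C * (2 * M))"
    using first second pos by (intro mult_left_mono order_trans[OF abs_triangle_ineq4] add_mono) auto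
  also have "\<dots> = C * ((1 / (R/4) + 2 * M) / \<alpha>)"
    by (simp add: algebra_simps add_divide_distrib)
  also have "\<dots> \<le> C * growth_rate"
    using C by (intro mult_left_mono) (auto simp: growth_rate_def)
  also have "\<dots> = growth_const * growth_rate ^ Suc (Suc n) / (R/4) ^ l * fact (Suc (Suc n) + 2 * l) powr \<mu>"
    by (simp add: C_def)
  finally show ?case .
qed

definition majorant :: "nat \<Rightarrow> nat \<Rightarrow> real \<Rightarrow> nat \<Rightarrow> real" where
  "majorant i l r n =
     growth_const * growth_rate ^ (n + i) / (R/4) ^ l * fact (n + i + 2 * l) powr \<mu> / fact n * r ^ n"

lemma summable_majorant:
  assumes "0 \<le> r"
  shows "summable (majorant i l r)"
proof -
  have "summable (\<lambda>n. growth_const * growth_rate ^ i / (R/4) ^ l *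
      ((growth_rate * r) ^ n * fact (n + (i + 2 * l)) powr \<mu> / fact n))"
    using \<mu> growth_pos assms by (intro summable_mult summable_gevrey) auto
  then show ?thesis
    by (rule back_subst[where P = summable])
      (auto simp: majorant_def fun_eq_iff power_add power_mult_distrib algebra_simps)
qed

lemma series_term_bound:
  assumes "0 \<le> t" "\<bar>z\<bar> \<le> r"
  shows "\<bar>jet (n + i) l t / fact n * z ^ n\<bar> \<le> majorant i l r n"
proof -
  have "\<bar>jet (n + i) l t / fact n * z ^ n\<bar> = \<bar>jet (n + i) l t\<bar> / fact n * \<bar>z\<bar> ^ n"
    by (simp add: abs_mult power_abs)
  also have "\<dots> \<le> majorant i l r n"
    unfolding majorant_def using assms growth_pos pos
    by (intro mult_mono divide_right_mono coeff_jet_bound power_mono) auto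
  finally show ?thesis .
qed

text \<open>The \<open>i\<close>-th spatial derivative of \<open>ref_temp - Tm\<close>.\<close>
definition series :: "nat \<Rightarrow> real \<Rightarrow> real \<Rightarrow> real" where
  "series i x t = (\<Sum>n. jet (n + i) 0 t / fact n * (x - sr t) ^ n)"

lemma summable_jet_series:
  assumes "0 \<le> t"
  shows "summable (\<lambda>n. jet (n + i) l t / fact n * z ^ n)"
  by (rule summable_comparison_test'[OF summable_majorant[of "\<bar>z\<bar>" i l]])
    (use series_term_bound[OF assms] in auto)

lemma continuous_on_sr: "continuous_on {0..} sr"
  using smooth unfolding smooth_in_time_def
  by (metis differentiable_imp_continuous_on funpow_0)

lemma continuous_on_jet: "continuous_on {0..} (jet n l)"
  by (rule DERIV_continuous_on) (use coeff_jet_deriv[OF smooth] in auto)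

lemma continuous_on_series:
  "continuous_on {(x, t). 0 \<le> t \<and> \<bar>x - sr t\<bar> \<le> r} (\<lambda>(x, t). series i x t)"
proof (cases "0 \<le> r")
  case True
  let ?A = "{(x, t). 0 \<le> t \<and> \<bar>x - sr t\<bar> \<le> r}"
  show ?thesis
  proof (rule uniform_limit_theorem)
    have "uniform_limit ?A (\<lambda>N p. \<Sum>n<N. (case p of (x, t) \<Rightarrow> jet (n + i) 0 t / fact n * (x - sr t) ^ n))
        (\<lambda>p. \<Sum>n. (case p of (x, t) \<Rightarrow> jet (n + i) 0 t / fact n * (x - sr t) ^ n)) sequentially"
      by (rule Weierstrass_m_test[OF _ summable_majorant[OF True, of i 0]])
        (use series_term_bound in auto)
    then show "uniform_limit ?A (\<lambda>N p. \<Sum>n<N. (case p of (x, t) \<Rightarrow> jet (n + i) 0 t / fact n * (x - sr t) ^ n))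
        (\<lambda>(x, t). series i x t) sequentially"
      by (simp add: series_def case_prod_unfold)
    have snd_in: "snd ` ?A \<subseteq> {0..}"
      by auto
    have "continuous_on ?A (\<lambda>p. jet (n + i) 0 (snd p) / fact n * (fst p - sr (snd p)) ^ n)" for n
      by (intro continuous_on_mult continuous_on_divide continuous_on_power continuous_on_diff
          continuous_on_compose2[OF continuous_on_jet _ snd_in]
          continuous_on_compose2[OF continuous_on_sr _ snd_in]
          continuous_on_fst continuous_on_snd continuous_on_id continuous_on_const) auto
    then show "\<forall>\<^sub>F N in sequentially. continuous_on ?A
        (\<lambda>p. \<Sum>n<N. (case p of (x, t) \<Rightarrow> jet (n + i) 0 t / fact n * (x - sr t) ^ n))"
      by (simp add: case_prod_unfold continuous_on_sum)
  qed simp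
next
  case False
  then have "\<not> \<bar>x - sr t\<bar> \<le> r" for x t
    by (smt (verit) abs_ge_zero)
  then have "{(x, t). 0 \<le> t \<and> \<bar>x - sr t\<bar> \<le> r} = {}"
    by simp
  then show ?thesis
    by (metis continuous_on_empty)
qed

lemma series_deriv_x:
  assumes t: "0 \<le> t"
  shows "((\<lambda>x. series i x t) has_real_derivative series (Suc i) x t) (at x)"
proof -
  define c where "c n = jet (n + i) 0 t / fact n" for n
  have "diffs c n = jet (n + Suc i) 0 t / fact n" for n
    by (simp add: diffs_def c_def del: of_nat_Suc)
  moreover have "((\<lambda>z. \<Sum>n. c n * z ^ n) has_real_derivative (\<Sum>n. diffs c n * (x - sr t) ^ n)) (at (x - sr t))"
    by (rule termdiffs_strong_converges_everywhere)
      (use summable_jet_series[OF t, of i 0] in \<open>simp add: c_def\<close>)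
  ultimately have "((\<lambda>z. \<Sum>n. c n * z ^ n) has_real_derivative series (Suc i) x t) (at (x - sr t))"
    by (simp add: series_def)
  moreover have "((\<lambda>x. x - sr t) has_real_derivative 1) (at x)"
    by (auto intro!: derivative_eq_intros)
  ultimately have "((\<lambda>x. \<Sum>n. c n * (x - sr t) ^ n) has_real_derivative series (Suc i) x t * 1) (at x)"
    by (rule DERIV_chain2)
  then show ?thesis
    by (simp add: series_def c_def)
qed

text \<open>Differentiating term by term produces the coefficients
  \<open>coeff_jet n 1 - time_deriv sr * coeff_jet (n + 1) 0\<close>, the second part after an index shift caused by the
  moving centre of expansion. By the recursion these are \<open>\<alpha> * coeff_jet (n + 2) 0\<close>: the recursion is the
  heat equation, read off coefficientwise.\<close>
lemma series_deriv_t: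
  assumes t: "0 < t"
  shows "((\<lambda>\<tau>. series 0 x \<tau>) has_real_derivative \<alpha> * series 2 x t) (at t)"
proof -
  define I where "I = {t/2..t + 1}"
  define r where "r = \<bar>x\<bar> + Z"
  have I: "0 < \<tau>" "\<bar>x - sr \<tau>\<bar> \<le> r" if "\<tau> \<in> I" for \<tau>
  proof -
    show "0 < \<tau>"
      using that t by (auto simp: I_def)
    then show "\<bar>x - sr \<tau>\<bar> \<le> r"
      using sr_range[of \<tau>] by (auto simp: r_def)
  qed
  have t_in: "t \<in> I" "t \<in> interior I"
    using t by (auto simp: I_def)
  have r: "0 \<le> r"
    using I(2)[OF t_in(1)] by linarith
  define f where "f n \<tau> = jet n 0 \<tau> / fact n * (x - sr \<tau>) ^ n" for n \<tau>
  define g where "g n \<tau> = jet n 0 \<tau> / fact n * (real n * (x - sr \<tau>) ^ (n - 1))" for n \<tau>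
  define f' where "f' n \<tau> = jet n 1 \<tau> / fact n * (x - sr \<tau>) ^ n - time_deriv sr \<tau> * g n \<tau>" for n \<tau>
  have g_0: "g 0 \<tau> = 0" and g_Suc: "g (Suc m) \<tau> = jet (m + 1) 0 \<tau> / fact m * (x - sr \<tau>) ^ m" for m \<tau>
    by (simp_all add: g_def del: of_nat_Suc)
  have deriv: "(f n has_real_derivative f' n \<tau>) (at \<tau> within I)" if \<tau>: "\<tau> \<in> I" for n \<tau>
  proof -
    have sub: "I \<subseteq> {0..}"
      using I(1) by (auto simp: less_imp_le)
    have "(jet n 0 has_real_derivative jet n 1 \<tau>) (at \<tau> within I)"
      using DERIV_subset[OF coeff_jet_deriv[OF smooth] sub] I(1)[OF \<tau>] by simp
    moreover have "(sr has_real_derivative time_deriv sr \<tau>) (at \<tau> within I)"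
      using DERIV_subset[OF time_deriv_iterate_deriv[OF smooth, of \<tau> 0] sub] I(1)[OF \<tau>] by simp
    then have "((\<lambda>\<tau>. (x - sr \<tau>) ^ n) has_real_derivative
        - (time_deriv sr \<tau> * (real n * (x - sr \<tau>) ^ (n - 1)))) (at \<tau> within I)"
      by (auto intro!: derivative_eq_intros)
    ultimately show ?thesis
      unfolding f_def f'_def g_def
      using DERIV_mult[OF DERIV_cdivide[of "jet n 0" "jet n 1 \<tau>" \<tau> I "fact n"]]
      by (fastforce simp: algebra_simps)
  qed
  have v_bound: "\<bar>time_deriv sr \<tau>\<bar> \<le> M" if "\<tau> \<in> I" for \<tau>
    using gevrey[of \<tau> 0] I(1)[OF that] by simp
  define B where "B n = majorant 0 1 r n + M * (case n of 0 \<Rightarrow> 0 | Suc m \<Rightarrow> majorant 1 0 r m)" for n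
  have "summable (\<lambda>n. case n of 0 \<Rightarrow> 0 | Suc m \<Rightarrow> majorant 1 0 r m)"
    by (subst summable_Suc_iff[symmetric]) (simp add: summable_majorant[OF r])
  then have "summable B"
    unfolding B_def by (intro summable_add summable_mult summable_majorant[OF r])
  have bound: "norm (f' n \<tau>) \<le> B n" if \<tau>: "\<tau> \<in> I" for n \<tau>
  proof -
    have "\<bar>g n \<tau>\<bar> \<le> (case n of 0 \<Rightarrow> 0 | Suc m \<Rightarrow> majorant 1 0 r m)"
      using series_term_bound[OF _ I(2)[OF \<tau>], of \<tau> _ 1 0] I(1)[OF \<tau>]
      by (cases n) (auto simp: g_0 g_Suc)
    then have "\<bar>time_deriv sr \<tau> * g n \<tau>\<bar> \<le> M * (case n of 0 \<Rightarrow> 0 | Suc m \<Rightarrow> majorant 1 0 r m)"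
      unfolding abs_mult using v_bound[OF \<tau>] pos by (intro mult_mono) auto
    moreover have "\<bar>jet n 1 \<tau> / fact n * (x - sr \<tau>) ^ n\<bar> \<le> majorant 0 1 r n"
      using series_term_bound[OF _ I(2)[OF \<tau>], of \<tau> n 0 1] I(1)[OF \<tau>] by simp
    ultimately show ?thesis
      unfolding f'_def B_def real_norm_def by (rule order_trans[OF abs_triangle_ineq4 add_mono, rotated])
  qed
  have "((\<lambda>\<tau>. \<Sum>n. f n \<tau>) has_real_derivative (\<Sum>n. f' n t)) (at t)"
  proof (rule has_field_derivative_series'(2)[OF _ deriv _ t_in(1) _ t_in(2)])
    show "convex I"
      by (simp add: I_def)
    show "uniformly_convergent_on I (\<lambda>n \<tau>. \<Sum>i<n. f' i \<tau>)"
      by (rule Weierstrass_m_test'[OF bound \<open>summable B\<close>])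
    show "summable (\<lambda>n. f n t)"
      using summable_jet_series[of t 0 0 "x - sr t"] t by (simp add: f_def)
  qed
  moreover have "(\<Sum>n. f' n t) = \<alpha> * series 2 x t"
  proof -
    have t0: "0 \<le> t"
      using t by simp
    have sums_g: "(\<lambda>n. g n t) sums (\<Sum>m. jet (m + 1) 0 t / fact m * (x - sr t) ^ m)"
    proof -
      have "(\<lambda>m. g (Suc m) t) sums (\<Sum>m. jet (m + 1) 0 t / fact m * (x - sr t) ^ m)"
        unfolding g_Suc by (rule summable_sums[OF summable_jet_series[OF t0]])
      then show ?thesis
        by (simp only: sums_Suc_iff[of "\<lambda>n. g n t"] g_0 add_0_right)
    qed
    have sums_1: "(\<lambda>n. jet n 1 t / fact n * (x - sr t) ^ n) sums (\<Sum>n. jet n 1 t / fact n * (x - sr t) ^ n)"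
      using summable_sums[OF summable_jet_series[OF t0, of 0 1 "x - sr t"]] by simp
    define L where "L = (\<Sum>n. jet n 1 t / fact n * (x - sr t) ^ n)
        - time_deriv sr t * (\<Sum>m. jet (m + 1) 0 t / fact m * (x - sr t) ^ m)"
    have sums_f': "(\<lambda>n. f' n t) sums L"
      unfolding f'_def L_def by (intro sums_diff sums_mult sums_1 sums_g)
    have recursion: "jet n 1 t / fact n * (x - sr t) ^ n
        - time_deriv sr t * (jet (n + 1) 0 t / fact n * (x - sr t) ^ n)
        = \<alpha> * (jet (n + 2) 0 t / fact n * (x - sr t) ^ n)" for n
      using pos by (simp add: field_simps numeral_2_eq_2)
    have "(\<lambda>n. jet n 1 t / fact n * (x - sr t) ^ n
        - time_deriv sr t * (jet (n + 1) 0 t / fact n * (x - sr t) ^ n)) sums L"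
      unfolding L_def by (intro sums_diff sums_mult sums_1 summable_sums[OF summable_jet_series[OF t0]])
    then have "(\<lambda>n. \<alpha> * (jet (n + 2) 0 t / fact n * (x - sr t) ^ n)) sums L"
      by (simp only: recursion)
    moreover have "(\<lambda>n. \<alpha> * (jet (n + 2) 0 t / fact n * (x - sr t) ^ n)) sums (\<alpha> * series 2 x t)"
      unfolding series_def by (intro sums_mult summable_sums[OF summable_jet_series[OF t0]])
    ultimately have "L = \<alpha> * series 2 x t"
      by (rule sums_unique2)
    then show ?thesis
      using sums_unique[OF sums_f'] by simp
  qed
  ultimately show ?thesis
    by (simp add: series_def f_def)
qed

lemma ref_temp_eq: "0 \<le> t \<Longrightarrow> ref_temp \<alpha> \<beta> \<epsilon> Tm sr x t = Tm + series 0 x t"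
  by (simp add: ref_temp_def series_def ref_coeff_eq_coeff_jet[OF smooth])

lemma ref_flux_eq: "0 \<le> t \<Longrightarrow> ref_flux \<alpha> k \<beta> \<epsilon> sr t = - k * series 1 0 t"
  by (simp add: ref_flux_def series_def ref_coeff_eq_coeff_jet[OF smooth])

theorem well_posed: "ref_well_posed \<alpha> k \<beta> \<epsilon> Tm sr"
proof -
  have domain: "\<bar>x - sr t\<bar> \<le> Z" if "0 \<le> t" "0 \<le> x" "x \<le> sr t" for x t
    using sr_range[OF that(1)] that by auto
  have cont: "continuous_on {(x, t). P t \<and> 0 \<le> x \<and> x \<le> sr t} (\<lambda>(x, t). series i x t)"
    if "\<And>t. P t \<Longrightarrow> 0 \<le> t" for i P
    by (rule continuous_on_subset[OF continuous_on_series[of Z]]) (use domain that in auto)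
  have cont_int: "continuous_on {(x, t). 0 < t \<and> 0 < x \<and> x < sr t} (\<lambda>(x, t). series i x t)" for i
    by (rule continuous_on_subset[OF continuous_on_series[of Z]]) (use domain in auto)
  have at_front: "series i (sr t) t = jet i 0 t" for i t
    using powser_zero[of "\<lambda>n. jet (n + i) 0 t / fact n"] by (simp add: series_def)
  have diff: "(time_deriv ^^ m) sr differentiable_on {0..}" for m
    using smooth by (simp add: smooth_in_time_def)
  have "stefan_plant \<alpha> k \<beta> \<epsilon> Tm (ref_flux \<alpha> k \<beta> \<epsilon> sr) (ref_temp \<alpha> \<beta> \<epsilon> Tm sr) sr"
    unfolding stefan_plant_def
  proof (intro conjI; (rule exI[of _ "series 1"], rule exI[of _ "series 2"],
        rule exI[of _ "\<lambda>x t. \<alpha> * series 2 x t"], intro conjI allI impI ballI)?)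
    show "sr differentiable_on {0..}"
      using diff[of 0] by simp
    show "continuous_on {0..} (time_deriv sr)"
      using differentiable_imp_continuous_on[OF diff[of 1]] by simp
    show "time_deriv sr differentiable_on {0<..}"
      by (rule differentiable_on_subset[of _ "{0..}"]) (use diff[of 1] in auto)
    have "continuous_on {(x, t). 0 \<le> t \<and> 0 \<le> x \<and> x \<le> sr t} (\<lambda>p. Tm + (case p of (x, t) \<Rightarrow> series 0 x t))"
      by (intro continuous_on_add continuous_on_const cont)
    then show "continuous_on {(x, t). 0 \<le> t \<and> 0 \<le> x \<and> x \<le> sr t} (\<lambda>(x, t). ref_temp \<alpha> \<beta> \<epsilon> Tm sr x t)"
      by (rule continuous_on_eq) (auto simp: ref_temp_eq)
    show "continuous_on {(x, t). 0 < t \<and> 0 \<le> x \<and> x \<le> sr t} (\<lambda>(x, t). series 1 x t)"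
      by (rule cont) simp
    show "continuous_on {(x, t). 0 < t \<and> 0 < x \<and> x < sr t} (\<lambda>(x, t). series 2 x t)"
      by (rule cont_int)
    show "continuous_on {(x, t). 0 < t \<and> 0 < x \<and> x < sr t} (\<lambda>(x, t). \<alpha> * series 2 x t)"
      using continuous_on_mult[OF continuous_on_const[of _ \<alpha>] cont_int[of 2]]
      by (simp add: case_prod_unfold)
  next
    fix t x :: real assume t: "0 < t" "x \<in> {0..sr t}"
    show "((\<lambda>\<xi>. ref_temp \<alpha> \<beta> \<epsilon> Tm sr \<xi> t) has_real_derivative series 1 x t) (at x within {0..sr t})"
      unfolding ref_temp_eq[OF less_imp_le[OF t(1)]]
      using DERIV_add[OF DERIV_const series_deriv_x[of t 0 x]] t
      by (simp add: has_field_derivative_at_within)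
  next
    fix t x :: real assume t: "0 < t" "x \<in> {0<..<sr t}"
    show "((\<lambda>\<xi>. series 1 \<xi> t) has_real_derivative series 2 x t) (at x)"
      using series_deriv_x[of t 1 x] t by (simp add: numeral_2_eq_2)
    have "((\<lambda>\<tau>. Tm + series 0 x \<tau>) has_real_derivative \<alpha> * series 2 x t) (at t)"
      using DERIV_add[OF DERIV_const series_deriv_t[OF t(1), of x]] by simp
    then show "((\<lambda>\<tau>. ref_temp \<alpha> \<beta> \<epsilon> Tm sr x \<tau>) has_real_derivative \<alpha> * series 2 x t) (at t)"
      by (rule has_field_derivative_transform_within_open[where S = "{0<..}"])
        (use t in \<open>auto simp: ref_temp_eq\<close>)
  next
    fix t :: real assume t: "0 < t"
    show "- k * series 1 0 t = ref_flux \<alpha> k \<beta> \<epsilon> sr t"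
      using t by (simp add: ref_flux_eq)
    show "ref_temp \<alpha> \<beta> \<epsilon> Tm sr (sr t) t = Tm"
      using t by (simp add: ref_temp_eq at_front)
    show "\<epsilon> * time_deriv (time_deriv sr) t = - time_deriv sr t - \<beta> * series 1 (sr t) t"
      using pos by (simp add: at_front)
  qed simp
  then show ?thesis
    unfolding ref_well_posed_def
    using summable_jet_series[where l = 0 and i = 0] summable_jet_series[where l = 0 and i = 1]
    by (simp add: ref_coeff_eq_coeff_jet[OF smooth])
qed

end

section \<open>Safety of the closed loop\<close>

theorem proposition3:
  fixes \<alpha> k \<beta> \<epsilon> L c Tm s0 v0 srbar d M R :: real
    and T0 sr s :: "real \<Rightarrow> real" and T :: "real \<Rightarrow> real \<Rightarrow> real"
  assumes pos: "\<alpha> > 0" "k > 0" "\<beta> > 0" "\<epsilon> > 0" "L > 0" "c > 0"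
    and A1: "0 < s0" "s0 < L"
      "\<exists>T0'. (\<forall>x\<in>{0..s0}. (T0 has_real_derivative T0' x) (at x within {0..s0})) \<and>
             continuous_on {0..s0} T0'"
      "\<forall>x\<in>{0..s0}. Tm \<le> T0 x" "T0 s0 = Tm"
    and A2: "0 \<le> v0"
    and smooth: "smooth_in_time sr"
    and A3: "1 \<le> d" "d \<le> 2" "M > 0" "R > 0"
      "\<forall>m. \<forall>t\<ge>0. \<bar>(time_deriv ^^ (m + 1)) sr t\<bar> \<le> M * fact m powr d / R ^ m"
    and A4: "sr 0 > 0" "\<forall>t\<ge>0. 0 \<le> time_deriv sr t" "(sr \<longlongrightarrow> srbar) at_top" "srbar < L"
    (* for d < 2 this follows from A3; for d = 2 the series may have a finite radius of convergence *)
    and ref: "d = 2 \<Longrightarrow> ref_well_posed \<alpha> k \<beta> \<epsilon> Tm sr"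
    and A5: "\<forall>t>0. \<forall>x\<in>{0<..<sr t}. Tm \<le> ref_temp \<alpha> \<beta> \<epsilon> Tm sr x t"
    and A6: "\<forall>t\<ge>0. energy \<alpha> k \<beta> \<epsilon> Tm T0 s0 v0
               \<le> ref_energy \<alpha> k \<beta> \<epsilon> Tm sr 0 + 1 / c * ref_flux \<alpha> k \<beta> \<epsilon> sr t * exp (c * t)"
      "\<forall>t\<ge>0. ref_energy \<alpha> k \<beta> \<epsilon> Tm sr t
               + (energy \<alpha> k \<beta> \<epsilon> Tm T0 s0 v0 - ref_energy \<alpha> k \<beta> \<epsilon> Tm sr 0) * exp (- c * t)
             < k / \<beta> * srbar"
    and closed_loop:
      "stefan_plant \<alpha> k \<beta> \<epsilon> Tm (tracking_control \<alpha> k \<beta> \<epsilon> Tm c sr T s) T s"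
      "stefan_initial T0 s0 v0 T s"
  (* Without the premise of the second clause (equilibrium data at rest and no heat input on (0,t))
     the front stays at s0 up to time t. *)
  shows "(\<forall>t>0. \<forall>x\<in>{0<..<s t}. Tm \<le> T x t) \<and>
    (\<forall>t>0. (\<exists>x\<in>{0..s0}. T0 x \<noteq> Tm) \<or> v0 \<noteq> 0 \<or>
        (\<exists>\<tau>\<in>{0<..<t}. energy \<alpha> k \<beta> \<epsilon> Tm T0 s0 v0
           < ref_energy \<alpha> k \<beta> \<epsilon> Tm sr 0 + 1 / c * ref_flux \<alpha> k \<beta> \<epsilon> sr \<tau> * exp (c * \<tau>))
      \<longrightarrow> s0 < s t) \<and>
    (\<forall>t\<ge>0. s t \<le> srbar) \<and>
    (\<forall>t\<ge>0. 0 \<le> time_deriv s t)"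
proof -
  have sr_diff: "sr differentiable_on {0..}"
    using smooth[unfolded smooth_in_time_def, rule_format, of 0] by simp
  have sr_mono: "sr a \<le> sr b" if "0 \<le> a" "a \<le> b" for a b
  proof (rule DERIV_nonneg_imp_increasing_open[OF that(2)])
    show "continuous_on {a..b} sr"
      using that by (intro continuous_on_subset[OF differentiable_imp_continuous_on[OF sr_diff]]) auto
    fix t assume "a < t" "t < b"
    then have t: "0 < t"
      using that by simp
    then show "\<exists>y. (sr has_real_derivative y) (at t) \<and> 0 \<le> y"
      using has_time_deriv[OF sr_diff, of t] A4(2) by (auto simp: at_within_nonneg_eq_at)
  qed
  have sr_pos: "0 < sr t" if "0 \<le> t" for t
    using sr_mono[of 0 t] that A4(1) by simp
  have sr_le: "sr t \<le> srbar" if "0 \<le> t" for t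
    using A4(3)
  proof (rule tendsto_lowerbound)
    show "\<forall>\<^sub>F \<tau> in at_top. sr t \<le> sr \<tau>"
      using sr_mono[OF that] by (auto intro: eventually_at_top_linorderI[of t])
  qed simp
  have "ref_well_posed \<alpha> k \<beta> \<epsilon> Tm sr"
  proof (cases "d = 2")
    case True
    then show ?thesis
      by (rule ref)
  next
    case False
    interpret gevrey_reference \<alpha> \<beta> \<epsilon> M R "d / 2" srbar sr
      using pos A3 False smooth sr_pos sr_le by unfold_locales auto
    show ?thesis
      by (rule well_posed)
  qed
  then have plant: "stefan_plant \<alpha> k \<beta> \<epsilon> Tm (ref_flux \<alpha> k \<beta> \<epsilon> sr) (ref_temp \<alpha> \<beta> \<epsilon> Tm sr) sr"
    by (simp add: ref_well_posed_def)
  obtain T0' where "\<forall>x\<in>{0..s0}. (T0 has_real_derivative T0' x) (at x within {0..s0})"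
    using A1(3) by blast
  then have T0_cont: "continuous_on {0..s0} T0"
    by (intro DERIV_continuous_on) auto
  have loop: "stefan_plant \<alpha> k \<beta> \<epsilon> Tm (\<lambda>t. ref_flux \<alpha> k \<beta> \<epsilon> sr t
      - c * (traj_energy \<alpha> k \<beta> \<epsilon> Tm T s t - ref_energy \<alpha> k \<beta> \<epsilon> Tm sr t)) T s"
    using closed_loop(1) by (simp only: tracking_control_def[abs_def])
  note safety = closed_loop_safety[OF pos(1-4,6) A1(1) T0_cont A1(4)[rule_format] A2 plant sr_pos
      ref_energy_def refl A6(1)[rule_format] A6(2)[rule_format] loop closed_loop(2)]
  show ?thesis
    using safety by (intro conjI allI impI ballI) (auto intro: less_imp_le)
qed

end
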